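(* Let $1<p<\infty$ and $p'=p/(p-1)$. Let $(\Omega,\mathcal{F},(\mathcal{F}_t)_{t\ge 0},\mathbb{P})$ be a complete filtered probability space whose filtration is right continuous and such that $\mathcal{F}_0$ contains all $\mathcal{F}$-null sets. Let $X$ be a uniformly integrable, adapted, càdlàg martingale with values in a separable Hilbert space, and let $w$ be a weight with $Q_p(w)<\infty$. Then \[ \| X^{\ast} \|_{L^p (w)} \leqslant \frac{p^{p'}}{p - 1} Q_p (w)^{1 / (p - 1)} \| X \|_{L^p (w)} . \]
   Context: $X^{\ast}=\sup_{t\ge 0}|X_t|$ is the maximal function of $X$. Martingales are identified with their closures, e.g. $X=X_\infty$. A weight is a positive uniformly integrable martingale $w_t$, and we write $w=w_\infty$. The dual weight $u$ is defined by $u^p w=u$, i.e. $u=w^{-1/(p-1)}$; for a stopping time $\tau$, $w_\tau=\mathbb{E}[w\mid\mathcal{F}_\tau]$ and $u_\tau=\mathbb{E}[u\mid\mathcal{F}_\tau]$. The $A_p$ characteristic is \[ Q_p(w)=\sup_{\tau}\Big\| \mathbb{E}\Big[\Big(\tfrac{w_\tau}{w}\Big)^{1/(p-1)}\,\Big|\,\mathcal{F}_\tau\Big]^{p-1}\Big\|_{\infty}=\sup_\tau\|w_\tau u_\tau^{p-1}\|_\infty, \] the supremum over all adapted stopping times $\tau$. The weighted norm is $\|X\|_{L^p(w)}=(\mathbb{E}[|X_\infty|^p w])^{1/p}$ and $\|X^\ast\|_{L^p(w)}=(\mathbb{E}[(X^\ast)^p w])^{1/p}$. *)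

theory Defs
  imports "HOL-Probability.Probability"
begin

definition enn_powr :: "ennreal \<Rightarrow> real \<Rightarrow> ennreal" where
  "enn_powr a r = (if a = \<top> then \<top> else ennreal (enn2real a powr r))"

definition usual_filtration :: "'a measure \<Rightarrow> (real \<Rightarrow> 'a measure) \<Rightarrow> bool" where
  "usual_filtration M F \<longleftrightarrow>
     (\<forall>t\<ge>0. subalgebra M (F t)) \<and>
     (\<forall>s t. 0 \<le> s \<longrightarrow> s \<le> t \<longrightarrow> sets (F s) \<subseteq> sets (F t)) \<and>
     (\<forall>t\<ge>0. sets (F t) = (\<Inter>s\<in>{t<..}. sets (F s))) \<and>
     null_sets M \<subseteq> sets (F 0)"

definition filt_infty :: "'a measure \<Rightarrow> (real \<Rightarrow> 'a measure) \<Rightarrow> 'a measure" where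
  "filt_infty M F = sigma (space M) (\<Union>t\<in>{0..}. sets (F t))"

definition stopping_time_r :: "'a measure \<Rightarrow> (real \<Rightarrow> 'a measure) \<Rightarrow> ('a \<Rightarrow> ennreal) \<Rightarrow> bool" where
  "stopping_time_r M F \<tau> \<longleftrightarrow> (\<forall>t\<ge>0. {x\<in>space M. \<tau> x \<le> ennreal t} \<in> sets (F t))"

definition filt_at :: "'a measure \<Rightarrow> (real \<Rightarrow> 'a measure) \<Rightarrow> ('a \<Rightarrow> ennreal) \<Rightarrow> 'a measure" where
  "filt_at M F \<tau> = sigma (space M)
     {A \<in> sets (filt_infty M F). \<forall>t\<ge>0. A \<inter> {x\<in>space M. \<tau> x \<le> ennreal t} \<in> sets (F t)}"

text \<open>Adapted, integrable martingale (vector valued): the martingale property is stated via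
  the defining property of the conditional expectation, E[X_t 1_A] = E[X_s 1_A] for A in F_s.\<close>
definition martingale_r :: "'a measure \<Rightarrow> (real \<Rightarrow> 'a measure) \<Rightarrow> (real \<Rightarrow> 'a \<Rightarrow> 'b::{banach, second_countable_topology}) \<Rightarrow> bool" where
  "martingale_r M F X \<longleftrightarrow>
     (\<forall>t\<ge>0. X t \<in> borel_measurable (F t)) \<and>
     (\<forall>t\<ge>0. integrable M (X t)) \<and>
     (\<forall>s t A. 0 \<le> s \<longrightarrow> s \<le> t \<longrightarrow> A \<in> sets (F s) \<longrightarrow>
        set_lebesgue_integral M A (X t) = set_lebesgue_integral M A (X s))"

definition unif_integrable :: "'a measure \<Rightarrow> (real \<Rightarrow> 'a \<Rightarrow> 'b::real_normed_vector) \<Rightarrow> bool" where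
  "unif_integrable M X \<longleftrightarrow>
     ((\<lambda>K::real. SUP t\<in>{0..}. \<integral>\<^sup>+ x. indicator {y. K < norm (X t y)} x * ennreal (norm (X t x)) \<partial>M)
        \<longlongrightarrow> 0) at_top"

definition cadlag :: "'a measure \<Rightarrow> (real \<Rightarrow> 'a \<Rightarrow> 'b::topological_space) \<Rightarrow> bool" where
  "cadlag M X \<longleftrightarrow> (\<forall>x\<in>space M.
     (\<forall>t\<ge>0. continuous (at_right t) (\<lambda>s. X s x)) \<and>
     (\<forall>t>0. \<exists>l. ((\<lambda>s. X s x) \<longlongrightarrow> l) (at_left t)))"

definition mart_limit :: "(real \<Rightarrow> 'a \<Rightarrow> 'b::t2_space) \<Rightarrow> 'a \<Rightarrow> 'b" where
  "mart_limit X x = Lim at_top (\<lambda>t. X t x)"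

definition maxfun :: "(real \<Rightarrow> 'a \<Rightarrow> 'b::real_normed_vector) \<Rightarrow> 'a \<Rightarrow> ennreal" where
  "maxfun X x = (SUP t\<in>{0..}. ennreal (norm (X t x)))"

text \<open>A weight, represented by its terminal value w = w_\<infinity> (w_t = E[w | F_t]).\<close>
definition weight :: "'a measure \<Rightarrow> (real \<Rightarrow> 'a measure) \<Rightarrow> ('a \<Rightarrow> real) \<Rightarrow> bool" where
  "weight M F w \<longleftrightarrow> w \<in> borel_measurable (filt_infty M F) \<and> integrable M w \<and> (AE x in M. 0 < w x)"

definition dual_weight :: "real \<Rightarrow> ('a \<Rightarrow> real) \<Rightarrow> 'a \<Rightarrow> ennreal" where
  "dual_weight p w x = ennreal (w x powr (- 1 / (p - 1)))"

definition Q_char :: "'a measure \<Rightarrow> (real \<Rightarrow> 'a measure) \<Rightarrow> real \<Rightarrow> ('a \<Rightarrow> real) \<Rightarrow> ennreal" where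
  "Q_char M F p w = (SUP \<tau>\<in>{\<tau>. stopping_time_r M F \<tau>}.
      esssup M (\<lambda>x. nn_cond_exp M (filt_at M F \<tau>) (\<lambda>y. ennreal (w y)) x *
                    enn_powr (nn_cond_exp M (filt_at M F \<tau>) (dual_weight p w) x) (p - 1)))"

definition wnorm :: "'a measure \<Rightarrow> real \<Rightarrow> ('a \<Rightarrow> real) \<Rightarrow> ('a \<Rightarrow> ennreal) \<Rightarrow> ennreal" where
  "wnorm M p w f = enn_powr (\<integral>\<^sup>+ x. enn_powr (f x) p * ennreal (w x) \<partial>M) (1 / p)"

end

(*
  Write f for the terminal variable |X_infinity| and u for the dual weight. With g_t = E_u[f/u | F_t]
  one has E[f | F_t] = u_t g_t, and w_t u_t^(p-1) <= Q turns this into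
  E[f | F_t]^(p-1) <= Q g_t^(p-1) / w_t <= Q E_w[(sup g)^(p-1) / w | F_t].
  Taking suprema in t, Doob's inequality in L^p'(w) followed by Doob's inequality in L^p(u) gives the
  bound with constant p^(1/(p-1)) p' = p^p' / (p-1). Only finitely many deterministic times enter at
  once; right continuity and Fatou's lemma give the maximal function.

  The closure |X_t| <= E[|X_infinity| | F_t] comes from strict convexity of phi(x) = sqrt(1+|x|^2):
  the expectations E phi(X_t) increase to a finite limit, and their increments are expected Bregman
  divergences, which together with uniform integrability control E|X_t - X_s|.
*)
theory Submission
  imports Defs
begin

text \<open>Only first moments of X are available, which is why the convex function is not
  \<open>|x|^2\<close>: sqrt(1+|x|^2) grows linearly, so its expectations are finite, and its
  gradient has norm at most 1, so the linear term of the divergence integrates to zero against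
  martingale increments. The price is that the divergence dominates |x-y|^2 only on balls; the tails
  outside a ball are left to uniform integrability. The dual weight may fail to be integrable:
  finiteness of Q only makes its conditional expectations finite almost everywhere, and the initial
  sigma-algebra need not be trivial. Doob's inequality under u dP is therefore localised to events
  of time 0 on which E[u | F_0] is bounded, and these events exhaust the space. No conditional
  expectation of a vector valued function is formed. Domination by E[h | G_k] is expressed through
  integrals against nonnegative G_k-measurable test functions, a form that survives truncation,
  change of measure and passage to the limit.\<close>

section \<open>Powers of extended nonnegative reals\<close>

lemma enn_powr_top [simp]: "enn_powr \<top> r = \<top>"
  by (simp add: enn_powr_def)

lemma enn_powr_ennreal [simp]: "0 \<le> x \<Longrightarrow> enn_powr (ennreal x) r = ennreal (x powr r)"
  by (simp add: enn_powr_def)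

lemma enn_powr_zero [simp]: "enn_powr 0 r = 0"
  by (simp add: enn_powr_def)

lemma enn_powr_one [simp]: "enn_powr a 1 = a"
  by (cases a) auto

lemma enn_powr_mono:
  assumes "a \<le> b" "0 \<le> r"
  shows "enn_powr a r \<le> enn_powr b r"
  using assms by (cases a; cases b) (auto simp: top_unique powr_mono2 intro!: ennreal_leI)

text \<open>The conventions \<open>0 * \<top> = 0\<close> and \<open>0 powr r = 0\<close> make the
  product rule hold at all arguments and for all real exponents, without side conditions.\<close>

lemma enn_powr_mult: "enn_powr (a * b) r = enn_powr a r * enn_powr b r"
  by (cases a; cases b)
     (auto simp: ennreal_mult_top ennreal_top_mult ennreal_mult[symmetric] powr_mult)

lemma enn_powr_powr: "enn_powr (enn_powr a r) s = enn_powr a (r * s)"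
  by (cases a) (auto simp: powr_powr)

text \<open>For \<open>r > 0\<close> the power is an order automorphism of the extended half line
  with inverse exponent \<open>1 / r\<close>, and such a map commutes with arbitrary
  suprema.\<close>

lemma enn_powr_SUP:
  assumes "0 < r"
  shows "enn_powr (SUP i\<in>I. f i) r = (SUP i\<in>I. enn_powr (f i) r)"
proof (rule antisym)
  have "f i \<le> enn_powr (SUP i\<in>I. enn_powr (f i) r) (1 / r)" if "i \<in> I" for i
    using enn_powr_mono[OF SUP_upper[OF that, of "\<lambda>i. enn_powr (f i) r"], of "1 / r"] assms
    by (simp add: enn_powr_powr)
  then have "enn_powr (SUP i\<in>I. f i) r
      \<le> enn_powr (enn_powr (SUP i\<in>I. enn_powr (f i) r) (1 / r)) r"
    using assms by (intro enn_powr_mono SUP_least) auto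
  then show "enn_powr (SUP i\<in>I. f i) r \<le> (SUP i\<in>I. enn_powr (f i) r)"
    using assms by (simp add: enn_powr_powr)
qed (use assms in \<open>auto intro!: SUP_least enn_powr_mono SUP_upper\<close>)

lemma measurable_enn_powr [measurable]:
  assumes [measurable]: "f \<in> borel_measurable M"
  shows "(\<lambda>x. enn_powr (f x) r) \<in> borel_measurable M"
  unfolding enn_powr_def by measurable

section \<open>Doob inequalities at finitely many times\<close>

text \<open>A summation by parts along the running maximum that serves both Doob inequalities:
  powers for \<open>\<phi>\<close> and \<open>\<psi>\<close> give the strong type, multiples of the
  indicator of a half line give the weak type. The hypothesis \<open>yh\<close> encodes that
  \<open>y k\<close> is at most the conditional expectation of \<open>h\<close>. The increment of
  \<open>\<psi>\<close> at step \<open>k + 1\<close> is \<open>G (Suc k)\<close>-measurable and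
  nonnegative, hence an admissible test function, and these increments telescope.\<close>

lemma running_maximum_le:
  fixes y :: "nat \<Rightarrow> 'a \<Rightarrow> real" and \<phi> \<psi> :: "real \<Rightarrow> real"
  assumes sub: "\<And>k. subalgebra N (G k)"
    and incr: "\<And>k. sets (G k) \<subseteq> sets (G (Suc k))"
    and y: "\<And>k. y k \<in> borel_measurable (G k)" "\<And>k x. 0 \<le> y k x"
    and h: "h \<in> borel_measurable N"
    and yh: "\<And>k Z. Z \<in> borel_measurable (G k) \<Longrightarrow>
      (\<integral>\<^sup>+ x. ennreal (y k x) * Z x \<partial>N) \<le> (\<integral>\<^sup>+ x. h x * Z x \<partial>N)"
    and \<psi>: "\<psi> \<in> borel_measurable borel" "\<psi> 0 = 0" "\<And>a b. 0 \<le> a \<Longrightarrow> a \<le> b \<Longrightarrow> \<psi> a \<le> \<psi> b"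
    and \<phi>: "\<phi> \<in> borel_measurable borel" "\<phi> 0 = 0"
      "\<And>a b. 0 \<le> a \<Longrightarrow> a \<le> b \<Longrightarrow> \<phi> b \<le> \<phi> a + b * (\<psi> b - \<psi> a)"
  shows "(\<integral>\<^sup>+ x. ennreal (\<phi> (Max ((\<lambda>k. y k x) ` {..n}))) \<partial>N)
    \<le> (\<integral>\<^sup>+ x. h x * ennreal (\<psi> (Max ((\<lambda>k. y k x) ` {..n}))) \<partial>N)"
proof -
  define m where "m = (\<lambda>k x. Max ((\<lambda>k. y k x) ` {..k}))"
  have m_0: "m 0 x = y 0 x" for x by (simp add: m_def)
  have m_Suc: "m (Suc k) x = max (y (Suc k) x) (m k x)" for k x
    by (simp add: m_def atMost_Suc)
  have m_nn: "0 \<le> m k x" for k x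
    by (induction k) (auto simp: m_0 m_Suc y le_max_iff_disj)
  have \<psi>_nn: "0 \<le> \<psi> a" if "0 \<le> a" for a
    using \<psi>(3)[of 0 a] that \<psi>(2) by simp
  note [measurable] = \<phi>(1) \<psi>(1) h y(1)
  have m_meas: "m k \<in> borel_measurable (G k)" for k
  proof (induction k)
    case 0
    have "m 0 = y 0" by (rule ext) (simp add: m_0)
    then show ?case by (simp add: y)
  next
    case (Suc k)
    have "subalgebra (G (Suc k)) (G k)"
      using sub incr unfolding subalgebra_def by auto
    from measurable_from_subalg[OF this Suc.IH]
    have [measurable]: "m k \<in> borel_measurable (G (Suc k))" .
    have "m (Suc k) = (\<lambda>x. max (y (Suc k) x) (m k x))" by (rule ext) (simp add: m_Suc)
    then show ?case by simp
  qed
  have [measurable]: "m k \<in> borel_measurable N" "y k \<in> borel_measurable N" for k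
    using measurable_from_subalg[OF sub m_meas] measurable_from_subalg[OF sub y(1)] by auto
  have "(\<integral>\<^sup>+ x. ennreal (\<phi> (m n x)) \<partial>N) \<le> (\<integral>\<^sup>+ x. h x * ennreal (\<psi> (m n x)) \<partial>N)"
  proof (induction n)
    case 0
    have "\<phi> (y 0 x) \<le> y 0 x * \<psi> (y 0 x)" for x
      using \<phi>(3)[of 0 "y 0 x"] y \<phi>(2) \<psi>(2) by simp
    then have "(\<integral>\<^sup>+ x. ennreal (\<phi> (m 0 x)) \<partial>N)
        \<le> (\<integral>\<^sup>+ x. ennreal (y 0 x) * ennreal (\<psi> (y 0 x)) \<partial>N)"
      by (intro nn_integral_mono) (simp add: m_0 ennreal_mult'[symmetric] y ennreal_leI)
    also have "\<dots> \<le> (\<integral>\<^sup>+ x. h x * ennreal (\<psi> (y 0 x)) \<partial>N)"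
      by (rule yh) simp
    finally show ?case by (simp add: m_0)
  next
    case (Suc k)
    let ?D = "\<lambda>x. ennreal (\<psi> (m (Suc k) x) - \<psi> (m k x))"
    have D: "?D \<in> borel_measurable (G (Suc k))"
    proof -
      have "subalgebra (G (Suc k)) (G k)"
        using sub incr unfolding subalgebra_def by auto
      note [measurable] = measurable_from_subalg[OF this m_meas] m_meas[of "Suc k"]
      show ?thesis by measurable
    qed
    \<comment> \<open>where the maximum increases, it equals the new value of the process\<close>
    have step: "\<phi> (m (Suc k) x) \<le> \<phi> (m k x) + y (Suc k) x * (\<psi> (m (Suc k) x) - \<psi> (m k x))" for x
      using \<phi>(3)[OF m_nn, of k x "m (Suc k) x"] by (auto simp: m_Suc max_def)
    have mono: "\<psi> (m k x) \<le> \<psi> (m (Suc k) x)" for x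
      by (rule \<psi>(3)[OF m_nn]) (simp add: m_Suc)
    \<comment> \<open>No sign is assumed for \<open>\<phi>\<close>, so \<open>ennreal\<close> may
      truncate; truncation at zero is monotone and subadditive, which preserves the pathwise
      bound.\<close>
    have "ennreal (\<phi> (m (Suc k) x)) \<le> ennreal (\<phi> (m k x)) + ennreal (y (Suc k) x) * ?D x" for x
    proof -
      have "ennreal (\<phi> (m (Suc k) x))
          \<le> ennreal (\<phi> (m k x)) + ennreal (y (Suc k) x * (\<psi> (m (Suc k) x) - \<psi> (m k x)))"
        using step[of x] mono[of x] y(2)[of "Suc k" x]
        by (smt (verit) ennreal_leI ennreal_plus_if ennreal_neg mult_nonneg_nonneg add_0 add.commute)
      then show ?thesis
        using y(2) mono by (simp add: ennreal_mult)
    qed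
    then have "(\<integral>\<^sup>+ x. ennreal (\<phi> (m (Suc k) x)) \<partial>N)
        \<le> (\<integral>\<^sup>+ x. ennreal (\<phi> (m k x)) + ennreal (y (Suc k) x) * ?D x \<partial>N)"
      by (rule nn_integral_mono)
    also have "\<dots> = (\<integral>\<^sup>+ x. ennreal (\<phi> (m k x)) \<partial>N) + (\<integral>\<^sup>+ x. ennreal (y (Suc k) x) * ?D x \<partial>N)"
      by (rule nn_integral_add) measurable
    also have "\<dots> \<le> (\<integral>\<^sup>+ x. h x * ennreal (\<psi> (m k x)) \<partial>N) + (\<integral>\<^sup>+ x. h x * ?D x \<partial>N)"
      by (intro add_mono Suc.IH yh D)
    also have "\<dots> = (\<integral>\<^sup>+ x. h x * ennreal (\<psi> (m k x)) + h x * ?D x \<partial>N)"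
      by (rule nn_integral_add[symmetric]) measurable
    also have "\<dots> = (\<integral>\<^sup>+ x. h x * ennreal (\<psi> (m (Suc k) x)) \<partial>N)"
      using mono \<psi>_nn[OF m_nn]
      by (intro nn_integral_cong) (simp add: distrib_left[symmetric] ennreal_plus[symmetric] del: ennreal_plus)
    finally show ?case .
  qed
  then show ?thesis by (simp add: m_def)
qed

text \<open>Young's inequality for \<open>b\<close> and \<open>a powr (p - 1)\<close>. The factor
  \<open>p / (p - 1)\<close> comes from solving \<open>\<psi>'(x) = \<phi>'(x) / x\<close> for
  \<open>\<phi>(x) = x powr p\<close>; it is the origin of Doob's constant.\<close>

lemma powr_increment_le:
  fixes a b p :: real
  assumes "1 < p" "0 \<le> a" "a \<le> b"
  shows "b powr p \<le> a powr p + b * (p / (p - 1) * b powr (p - 1) - p / (p - 1) * a powr (p - 1))"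
proof -
  have "b * a powr (p - 1) \<le> b powr p / p + (a powr (p - 1)) powr (p / (p - 1)) / (p / (p - 1))"
    using assms by (intro Youngs_inequality) (auto simp: field_simps)
  also have "(a powr (p - 1)) powr (p / (p - 1)) = a powr p"
    using assms by (simp add: powr_powr)
  finally have "p * (b * a powr (p - 1)) \<le> b powr p + (p - 1) * a powr p"
    using assms by (simp add: field_simps)
  moreover have "b * b powr (p - 1) = b powr p"
    using assms by (cases "b = 0") (auto simp: powr_mult_base)
  moreover have "(p - 1) * (a powr p + b * (p / (p - 1) * b powr (p - 1) - p / (p - 1) * a powr (p - 1)))
      = (p - 1) * a powr p + p * (b * b powr (p - 1) - b * a powr (p - 1))"
  proof -
    have "(p - 1) * (a powr p + b * (q * B - q * A)) = (p - 1) * a powr p + ((p - 1) * q) * (b * B - b * A)" for q A B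
      by (simp add: algebra_simps)
    from this[of "p / (p - 1)" "b powr (p - 1)" "a powr (p - 1)"] show ?thesis
      using assms by simp
  qed
  ultimately have "(p - 1) * b powr p \<le> (p - 1) * (a powr p + b * (p / (p - 1) * b powr (p - 1) - p / (p - 1) * a powr (p - 1)))"
    using assms by (simp add: algebra_simps)
  then show ?thesis using assms by simp
qed

text \<open>The bound \<open>c\<close> on a finite measure space makes the left side finite, so that
  the part of it produced on the right by Young's inequality can be absorbed.\<close>

lemma doob_Lp_bounded:
  fixes y :: "nat \<Rightarrow> 'a \<Rightarrow> real"
  assumes p: "1 < p" and fin: "finite_measure N"
    and sub: "\<And>k. subalgebra N (G k)"
    and incr: "\<And>k. sets (G k) \<subseteq> sets (G (Suc k))"
    and y: "\<And>k. y k \<in> borel_measurable (G k)" "\<And>k x. 0 \<le> y k x" "\<And>k x. y k x \<le> c"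
    and h: "h \<in> borel_measurable N"
    and yh: "\<And>k Z. Z \<in> borel_measurable (G k) \<Longrightarrow>
      (\<integral>\<^sup>+ x. ennreal (y k x) * Z x \<partial>N) \<le> (\<integral>\<^sup>+ x. h x * Z x \<partial>N)"
  shows "(\<integral>\<^sup>+ x. ennreal (Max ((\<lambda>k. y k x) ` {..n}) powr p) \<partial>N)
    \<le> ennreal ((p / (p - 1)) powr p) * (\<integral>\<^sup>+ x. enn_powr (h x) p \<partial>N)"
proof -
  interpret finite_measure N by (rule fin)
  define q where "q = p / (p - 1)"
  have q: "1 < q" "1 / p + 1 / q = 1" "(p - 1) * q = p"
    using p by (auto simp: q_def field_simps)
  define m where "m = (\<lambda>x. Max ((\<lambda>k. y k x) ` {..n}))"
  have [measurable]: "y k \<in> borel_measurable N" for k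
    using measurable_from_subalg[OF sub y(1)] .
  note [measurable] = h
  have m[measurable]: "m \<in> borel_measurable N"
    unfolding m_def by (intro borel_measurable_Max) auto
  have m_nn: "0 \<le> m x" for x
    using y(2)[of 0 x] unfolding m_def by (subst Max_ge_iff) auto
  have m_le: "m x \<le> c" for x
    using y(3) unfolding m_def by (subst Max_le_iff) auto
  let ?I = "\<integral>\<^sup>+ x. ennreal (m x powr p) \<partial>N"
  let ?H = "\<integral>\<^sup>+ x. enn_powr (h x) p \<partial>N"
  have "?I \<le> (\<integral>\<^sup>+ x. ennreal (c powr p) \<partial>N)"
    using p m_nn m_le by (intro nn_integral_mono ennreal_leI powr_mono2) auto
  also have "\<dots> < \<top>"
    by (simp add: less_top[symmetric] ennreal_mult_eq_top_iff)
  finally have I_fin: "?I < \<top>" .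
  have "?I \<le> (\<integral>\<^sup>+ x. h x * ennreal (q * m x powr (p - 1)) \<partial>N)"
    unfolding m_def q_def
    using p by (intro running_maximum_le[where \<phi> = "\<lambda>x. x powr p" and \<psi> = "\<lambda>x. p / (p - 1) * x powr (p - 1)" and G = G]
        sub incr y h yh powr_increment_le) (auto intro!: divide_right_mono mult_left_mono powr_mono2)
  \<comment> \<open>Young's inequality with \<open>q\<close> attached to \<open>h\<close>, not to
    the maximum: once \<open>1 / q\<close> of the left side is absorbed, the same factor
    \<open>1 / p\<close> remains on both sides, and the constant is exactly
    \<open>q powr p\<close>.\<close>
  also have "\<dots> \<le> (\<integral>\<^sup>+ x. ennreal (1 / p * q powr p) * enn_powr (h x) p + ennreal (1 / q) * ennreal (m x powr p) \<partial>N)"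
  proof (rule nn_integral_mono)
    fix x
    show "h x * ennreal (q * m x powr (p - 1))
      \<le> ennreal (1 / p * q powr p) * enn_powr (h x) p + ennreal (1 / q) * ennreal (m x powr p)"
    proof (cases "h x")
      case (real r)
      have "(q * r) * m x powr (p - 1) \<le> (q * r) powr p / p + (m x powr (p - 1)) powr q / q"
        using p q real by (intro Youngs_inequality) auto
      also have "\<dots> = 1 / p * q powr p * r powr p + 1 / q * (m x powr p)"
        using p q real by (simp add: powr_powr powr_mult)
      finally show ?thesis
        using real p q by (simp add: ennreal_mult'[symmetric] ennreal_plus[symmetric] ennreal_leI ac_simps del: ennreal_plus)
    next
      case top
      then show ?thesis using p q by (simp add: ennreal_mult_top)
    qed
  qed
  also have "\<dots> = ennreal (1 / p * q powr p) * ?H + ennreal (1 / q) * ?I"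
    by (simp add: nn_integral_add nn_integral_cmult)
  finally have *: "?I \<le> ennreal (1 / p * q powr p) * ?H + ennreal (1 / q) * ?I" .
  have "?I \<le> ennreal (q powr p) * ?H"
  proof (cases "?H")
    case (real H)
    obtain I where I: "?I = ennreal I" "0 \<le> I"
      using I_fin by (cases ?I) auto
    have "I \<le> 1 / p * q powr p * H + 1 / q * I"
      using * p q I real by (simp add: ennreal_mult'[symmetric] ennreal_plus[symmetric] del: ennreal_plus)
    then have "1 / p * I \<le> 1 / p * (q powr p * H)"
      using q(2) by (simp add: algebra_simps) (metis add_left_mono  mult.commute mult.right_neutral distrib_left add.commute add_le_cancel_right times_divide_eq_right)
    then have "I \<le> q powr p * H"
      using p by (simp add: divide_le_cancel)
    then show ?thesis
      using real I by (simp add: ennreal_mult'[symmetric] ennreal_leI)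
  next
    case top
    then show ?thesis using q by (simp add: ennreal_mult_top)
  qed
  then show ?thesis by (simp add: m_def q_def)
qed

lemma ennreal_enn2real_min: "ennreal (enn2real (min a (ennreal (real j)))) = min a (ennreal (real j))"
  by (cases a) (auto simp: min_def top_unique)

text \<open>Values in the extended half line are reduced to the bounded case by cutting off at level
  \<open>j\<close>. The cut-off process need not be a submartingale, but its domination by
  \<open>h\<close> is inherited, and this is all the bounded case asks for. Since powers commute
  with suprema, monotone convergence in \<open>j\<close> finishes.\<close>

lemma doob_Lp:
  fixes Y :: "nat \<Rightarrow> 'a \<Rightarrow> ennreal"
  assumes p: "1 < p" and fin: "finite_measure N"
    and sub: "\<And>k. subalgebra N (G k)"
    and incr: "\<And>k. sets (G k) \<subseteq> sets (G (Suc k))"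
    and Y: "\<And>k. Y k \<in> borel_measurable (G k)"
    and h: "h \<in> borel_measurable N"
    and Yh: "\<And>k Z. Z \<in> borel_measurable (G k) \<Longrightarrow>
      (\<integral>\<^sup>+ x. Y k x * Z x \<partial>N) \<le> (\<integral>\<^sup>+ x. h x * Z x \<partial>N)"
  shows "(\<integral>\<^sup>+ x. enn_powr (SUP k\<in>{..n}. Y k x) p \<partial>N)
    \<le> ennreal ((p / (p - 1)) powr p) * (\<integral>\<^sup>+ x. enn_powr (h x) p \<partial>N)"
proof -
  define y where "y = (\<lambda>j k x. enn2real (min (Y k x) (ennreal (real j))))"
  have y_eq: "ennreal (y j k x) = min (Y k x) (ennreal (real j))" for j k x
    unfolding y_def by (rule ennreal_enn2real_min)
  note [measurable] = Y
  have y_meas[measurable]: "y j k \<in> borel_measurable (G k)" for j k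
    unfolding y_def by measurable
  note [measurable] = measurable_from_subalg[OF sub y_meas]
  have y_nn: "0 \<le> y j k x" for j k x by (simp add: y_def)
  have y_le: "y j k x \<le> real j" for j k x
    using y_eq[of j k x] by (metis ennreal_le_iff min.cobounded2 of_nat_0_le_iff)
  let ?B = "ennreal ((p / (p - 1)) powr p) * (\<integral>\<^sup>+ x. enn_powr (h x) p \<partial>N)"
  let ?m = "\<lambda>j x. Max ((\<lambda>k. y j k x) ` {..n})"
  have bound: "(\<integral>\<^sup>+ x. ennreal (?m j x powr p) \<partial>N) \<le> ?B" for j
  proof (rule doob_Lp_bounded[where G = G and y = "y j", OF p fin sub incr y_meas[of j] y_nn[of j] y_le[of j] h])
    fix k and Z :: "'a \<Rightarrow> ennreal" assume Z: "Z \<in> borel_measurable (G k)"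
    have "(\<integral>\<^sup>+ x. ennreal (y j k x) * Z x \<partial>N) \<le> (\<integral>\<^sup>+ x. Y k x * Z x \<partial>N)"
      by (intro nn_integral_mono mult_right_mono) (auto simp: y_eq)
    also have "\<dots> \<le> (\<integral>\<^sup>+ x. h x * Z x \<partial>N)" by (rule Yh[OF Z])
    finally show "(\<integral>\<^sup>+ x. ennreal (y j k x) * Z x \<partial>N) \<le> (\<integral>\<^sup>+ x. h x * Z x \<partial>N)" .
  qed
  have m_eq: "ennreal (?m j x) = (SUP k\<in>{..n}. min (Y k x) (ennreal (real j)))" for j x
  proof -
    have "ennreal (?m j x) = Max (ennreal ` (\<lambda>k. y j k x) ` {..n})"
      by (rule mono_Max_commute) (auto intro!: monoI ennreal_leI)
    also have "\<dots> = (SUP k\<in>{..n}. ennreal (y j k x))"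
      by (simp add: image_image Max_Sup)
    finally show ?thesis by (simp add: y_eq)
  qed
  have m_nn: "0 \<le> ?m j x" for j x
    using y_nn[of j 0 x] by (subst Max_ge_iff) auto
  have powr_m: "ennreal (?m j x powr p) = (SUP k\<in>{..n}. enn_powr (min (Y k x) (ennreal (real j))) p)" for j x
    using enn_powr_SUP[of p "\<lambda>k. min (Y k x) (ennreal (real j))" "{..n}"] m_eq[of j x] m_nn[of j x] p
    by (metis enn_powr_ennreal less_trans zero_less_one)
  have sup_min: "(SUP j. min a (ennreal (real j))) = a" for a :: ennreal
  proof (rule antisym)
    show "a \<le> (SUP j. min a (ennreal (real j)))"
    proof (cases a)
      case (real r)
      obtain j where "r \<le> real j" using real_arch_simple by blast
      then have "a = min a (ennreal (real j))" using real by (simp add: min_def ennreal_leI)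
      then show ?thesis by (metis SUP_upper UNIV_I)
    next
      case top
      have "\<top> = (SUP j. ennreal (real j))"
        by (metis SUP_cong ennreal_SUP_of_nat_eq_top ennreal_of_nat_eq_real_of_nat)
      then show ?thesis using top by simp
    qed
  qed (auto intro!: SUP_least)
  have "enn_powr (SUP k\<in>{..n}. Y k x) p = (SUP j. ennreal (?m j x powr p))" for x
  proof -
    have "enn_powr (SUP k\<in>{..n}. Y k x) p
        = enn_powr (SUP k\<in>{..n}. SUP j. min (Y k x) (ennreal (real j))) p"
      by (simp only: sup_min)
    also have "\<dots> = (SUP k\<in>{..n}. SUP j. enn_powr (min (Y k x) (ennreal (real j))) p)"
      using p by (simp only: enn_powr_SUP)
    also have "\<dots> = (SUP j. SUP k\<in>{..n}. enn_powr (min (Y k x) (ennreal (real j))) p)"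
      by (rule SUP_commute)
    finally show ?thesis by (simp only: powr_m)
  qed
  then have "(\<integral>\<^sup>+ x. enn_powr (SUP k\<in>{..n}. Y k x) p \<partial>N)
      = (\<integral>\<^sup>+ x. (SUP j. ennreal (?m j x powr p)) \<partial>N)"
    by simp
  also have "\<dots> = (SUP j. \<integral>\<^sup>+ x. ennreal (?m j x powr p) \<partial>N)"
  proof (rule nn_integral_monotone_convergence_SUP)
    show "incseq (\<lambda>j x. ennreal (?m j x powr p))"
      unfolding powr_m using p
      by (auto simp: incseq_def le_fun_def intro!: SUP_mono' enn_powr_mono min.mono ennreal_leI)
    show "(\<lambda>x. ennreal (?m j x powr p)) \<in> borel_measurable N" for j
      by measurable
  qed
  also have "\<dots> \<le> ?B" by (rule SUP_least) (rule bound)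
  finally show ?thesis .
qed

section \<open>The weighted inequality at finitely many times\<close>

text \<open>The set where the conditional expectation vanishes belongs to \<open>F\<close>, so
  \<open>g\<close> integrates to zero over it. This permits division by conditional expectations of
  weights.\<close>

lemma (in sigma_finite_subalgebra) nn_cond_exp_pos:
  assumes [measurable]: "g \<in> borel_measurable M" and pos: "AE x in M. 0 < g x"
  shows "AE x in M. 0 < nn_cond_exp M F g x"
proof -
  define B where "B = {x \<in> space F. nn_cond_exp M F g x = 0}"
  have B[measurable]: "B \<in> sets F" unfolding B_def by measurable
  then have [measurable]: "B \<in> sets M" using subalg by (auto simp: subalgebra_def)
  have "(\<integral>\<^sup>+ x. indicator B x * g x \<partial>M) = (\<integral>\<^sup>+ x. indicator B x * nn_cond_exp M F g x \<partial>M)"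
    by (rule nn_cond_exp_intg[symmetric]) auto
  also have "\<dots> = (\<integral>\<^sup>+ x. 0 \<partial>M)"
    by (intro nn_integral_cong) (auto simp: B_def indicator_def)
  finally have "AE x in M. indicator B x * g x = 0"
    by (simp add: nn_integral_0_iff_AE)
  then show ?thesis
    using pos AE_space
  proof eventually_elim
    case (elim x)
    then show ?case
      using subalg by (auto simp: B_def subalgebra_def indicator_def zero_less_iff_neq_zero)
  qed
qed

text \<open>From \<open>u powr (1 - p) = w\<close>: division by \<open>u\<close> carries the norm of
  L^p(w) to that of L^p(u).\<close>

lemma dual_weight_mult:
  assumes "1 < p" "0 < w x"
  shows "dual_weight p w x * enn_powr (a / dual_weight p w x) p = enn_powr a p * ennreal (w x)"
proof -
  define r where "r = w x powr (- 1 / (p - 1))"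
  have r: "0 < r" using assms by (simp add: r_def)
  have "r * (1 / r) powr p = r powr (1 - p)"
    using r by (simp add: powr_diff powr_divide)
  also have "\<dots> = w x"
  proof -
    have "- 1 / (p - 1) * (1 - p) = 1" using assms by (simp add: field_simps)
    then show ?thesis using assms by (simp only: r_def powr_powr) simp
  qed
  finally have *: "r * (1 / r) powr p = w x" .
  have "a / ennreal r = a * ennreal (1 / r)"
    using r by (metis divide_ennreal ennreal_1 ennreal_times_divide mult.right_neutral less_le zero_le_one)
  then have "ennreal r * enn_powr (a / ennreal r) p = enn_powr a p * (ennreal r * ennreal ((1 / r) powr p))"
    using r by (simp add: enn_powr_mult ac_simps)
  also have "ennreal r * ennreal ((1 / r) powr p) = ennreal (w x)"
    using r * by (simp add: ennreal_mult[symmetric])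
  finally show ?thesis by (simp add: dual_weight_def r_def)
qed

text \<open>The companion rule for the conjugate exponent, from \<open>w powr (1 - q) = u\<close>
  with \<open>q = p / (p - 1)\<close>: division by \<open>w\<close> carries the norm of L^q(u) to
  that of L^q(w).\<close>

lemma weight_mult_dual_powr:
  assumes "1 < p" "0 < w x"
  shows "ennreal (w x) * enn_powr (a / ennreal (w x)) (p / (p - 1))
    = enn_powr a (p / (p - 1)) * dual_weight p w x"
proof -
  have "w x * (1 / w x) powr (p / (p - 1)) = w x powr (1 - p / (p - 1))"
    using assms by (simp add: powr_diff powr_divide)
  also have "1 - p / (p - 1) = - 1 / (p - 1)"
    using assms by (simp add: field_simps)
  finally have *: "w x * (1 / w x) powr (p / (p - 1)) = w x powr (- 1 / (p - 1))" .
  have "a / ennreal (w x) = a * ennreal (1 / w x)"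
    using assms by (metis divide_ennreal ennreal_1 ennreal_times_divide mult.right_neutral zero_le_one)
  then have "ennreal (w x) * enn_powr (a / ennreal (w x)) (p / (p - 1))
      = enn_powr a (p / (p - 1)) * (ennreal (w x) * ennreal ((1 / w x) powr (p / (p - 1))))"
    using assms by (simp add: enn_powr_mult ac_simps)
  also have "ennreal (w x) * ennreal ((1 / w x) powr (p / (p - 1))) = dual_weight p w x"
    using assms * by (simp add: ennreal_mult[symmetric] dual_weight_def)
  finally show ?thesis .
qed

lemma ennreal_divide_mult_cancel:
  fixes a b :: ennreal
  assumes "0 < b" "b < \<top>"
  shows "a / b * b = a" "b * (a / b) = a"
  using assms
  by (simp_all add: ennreal_divide_times ennreal_times_divide ennreal_divide_self
      ennreal_mult_divide_eq mult.commute[of b] flip: zero_less_iff_neq_zero)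

text \<open>Bayes' rule: under the measure with density \<open>u\<close> on \<open>A\<close>, the
  quotient of \<open>Y k\<close> by the conditional expectation of \<open>u\<close> is dominated by
  the conditional expectation of \<open>f / u\<close>. A \<open>G k\<close>-measurable factor lets
  \<open>u\<close> be exchanged for its conditional expectation, which then cancels the denominator.
  Membership of \<open>A\<close> in \<open>G 0\<close> keeps its indicator an admissible factor at
  every \<open>k\<close>, and integrability of \<open>u\<close> over \<open>A\<close> makes the new
  measure finite. The lemma serves for the dual weight with exponent \<open>p\<close> and for the
  weight with the conjugate exponent.\<close>

lemma doob_density:
  fixes Y :: "nat \<Rightarrow> 'a \<Rightarrow> ennreal"
  assumes p: "1 < p" and fin: "finite_measure M"
    and sub: "\<And>k. subalgebra M (G k)"
    and incr: "\<And>k. sets (G k) \<subseteq> sets (G (Suc k))"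
    and Y: "\<And>k. Y k \<in> borel_measurable (G k)"
    and f: "f \<in> borel_measurable M"
    and Yf: "\<And>k Z. Z \<in> borel_measurable (G k) \<Longrightarrow>
      (\<integral>\<^sup>+ x. Y k x * Z x \<partial>M) \<le> (\<integral>\<^sup>+ x. f x * Z x \<partial>M)"
    and u: "u \<in> borel_measurable M" "AE x in M. 0 < u x" "AE x in M. u x < \<top>"
    and U: "\<And>k. AE x in M. nn_cond_exp M (G k) u x < \<top>"
    and A: "A \<in> sets (G 0)" "(\<integral>\<^sup>+ x. indicator A x * u x \<partial>M) < \<top>"
  shows "(\<integral>\<^sup>+ x. indicator A x * (u x * enn_powr (SUP k\<in>{..n}. Y k x / nn_cond_exp M (G k) u x) p) \<partial>M)
    \<le> ennreal ((p / (p - 1)) powr p) * (\<integral>\<^sup>+ x. indicator A x * (u x * enn_powr (f x / u x) p) \<partial>M)"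
proof -
  have sf: "sigma_finite_subalgebra M (G k)" for k
    using fin sub by (intro finite_measure_subalgebra_is_sigma_finite finite_measure_subalgebra.intro)
      (auto simp: finite_measure_subalgebra_axioms_def)
  define U where "U = (\<lambda>k. nn_cond_exp M (G k) u)"
  have U_pos: "AE x in M. 0 < U k x" for k
    unfolding U_def using sigma_finite_subalgebra.nn_cond_exp_pos[OF sf u(1,2)] .
  have A_G: "A \<in> sets (G k)" for k
    using A(1) lift_Suc_mono_le[of "\<lambda>k. sets (G k)" 0 k, OF incr] by auto
  have [measurable]: "A \<in> sets M" using A_G[of 0] sub[of 0] by (auto simp: subalgebra_def)
  have [measurable]: "U k \<in> borel_measurable M" for k by (simp add: U_def)
  have [measurable]: "Y k \<in> borel_measurable M" for k
    using measurable_from_subalg[OF sub Y] .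
  note [measurable] = f u(1)
  define N where "N = density M (\<lambda>x. indicator A x * u x)"
  have N_int: "(\<integral>\<^sup>+ x. F x \<partial>N) = (\<integral>\<^sup>+ x. indicator A x * (u x * F x) \<partial>M)" if "F \<in> borel_measurable M" for F
    unfolding N_def using that by (subst nn_integral_density) (auto simp: ac_simps)
  have subN: "subalgebra N (G k)" for k
    using sub[of k] by (simp add: subalgebra_def N_def)
  have "(\<integral>\<^sup>+ x. enn_powr (SUP k\<in>{..n}. Y k x / U k x) p \<partial>N)
      \<le> ennreal ((p / (p - 1)) powr p) * (\<integral>\<^sup>+ x. enn_powr (f x / u x) p \<partial>N)"
  proof (rule doob_Lp[where G = G, OF p _ subN incr])
    show "finite_measure N"
      using A(2) by (intro finite_measureI) (simp add: N_def emeasure_density less_top[symmetric]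
          nn_set_integral_space cong: nn_integral_cong_simp)
    show "(\<lambda>x. Y k x / U k x) \<in> borel_measurable (G k)" for k
      unfolding U_def using Y[of k] by measurable
    show "(\<lambda>x. f x / u x) \<in> borel_measurable N"
      unfolding N_def by measurable
  next
    fix k and Z :: "'a \<Rightarrow> ennreal" assume Z[measurable]: "Z \<in> borel_measurable (G k)"
    have [measurable]: "Z \<in> borel_measurable M"
      using measurable_from_subalg[OF sub Z] .
    have AZ: "(\<lambda>x. indicator A x * Z x) \<in> borel_measurable (G k)"
      using A_G[of k] Z by measurable
    have AYZ: "(\<lambda>x. indicator A x * (Y k x / U k x * Z x)) \<in> borel_measurable (G k)"
      unfolding U_def using A_G[of k] Z Y[of k] by measurable
    have "(\<integral>\<^sup>+ x. Y k x / U k x * Z x \<partial>N) = (\<integral>\<^sup>+ x. indicator A x * (Y k x / U k x * Z x) * u x \<partial>M)"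
      by (subst N_int) (auto simp: ac_simps)
    also have "\<dots> = (\<integral>\<^sup>+ x. indicator A x * (Y k x / U k x * Z x) * U k x \<partial>M)"
      unfolding U_def
      by (rule sigma_finite_subalgebra.nn_cond_exp_intg[OF sf, symmetric]) (use AYZ in \<open>auto simp: U_def\<close>)
    also have "\<dots> = (\<integral>\<^sup>+ x. Y k x * (indicator A x * Z x) \<partial>M)"
    proof (rule nn_integral_cong_AE)
      show "AE x in M. indicator A x * (Y k x / U k x * Z x) * U k x = Y k x * (indicator A x * Z x)"
        using U_pos[of k] U[of k]
      proof eventually_elim
        case (elim x)
        then have "Y k x / U k x * U k x = Y k x"
          by (intro ennreal_divide_mult_cancel) (auto simp: U_def)
        then show ?case by (metis mult.commute mult.left_commute)
      qed
    qed
    also have "\<dots> \<le> (\<integral>\<^sup>+ x. f x * (indicator A x * Z x) \<partial>M)"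
      by (rule Yf[OF AZ])
    also have "\<dots> = (\<integral>\<^sup>+ x. indicator A x * (u x * (f x / u x * Z x)) \<partial>M)"
    proof (rule nn_integral_cong_AE)
      show "AE x in M. f x * (indicator A x * Z x) = indicator A x * (u x * (f x / u x * Z x))"
        using u(2,3)
      proof eventually_elim
        case (elim x)
        then have "u x * (f x / u x) = f x"
          by (intro ennreal_divide_mult_cancel)
        then show ?case by (metis mult.commute mult.left_commute)
      qed
    qed
    also have "\<dots> = (\<integral>\<^sup>+ x. f x / u x * Z x \<partial>N)"
      by (subst N_int) auto
    finally show "(\<integral>\<^sup>+ x. Y k x / U k x * Z x \<partial>N) \<le> (\<integral>\<^sup>+ x. f x / u x * Z x \<partial>N)" .
  qed
  then show ?thesis
    by (simp add: N_int) (simp add: U_def)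
qed

text \<open>The two Doob inequalities are chained through \<open>v\<close>, the power
  \<open>p - 1\<close> of the first maximal function: its \<open>q\<close>-th power relative to
  \<open>w\<close> is the \<open>p\<close>-th power of that function relative to \<open>u\<close>,
  so the output of one inequality is the input of the other.\<close>

lemma weighted_doob_discrete:
  fixes Y :: "nat \<Rightarrow> 'a \<Rightarrow> ennreal" and w :: "'a \<Rightarrow> real"
  assumes p: "1 < p" and fin: "finite_measure M"
    and sub: "\<And>k. subalgebra M (G k)"
    and incr: "\<And>k. sets (G k) \<subseteq> sets (G (Suc k))"
    and Y: "\<And>k. Y k \<in> borel_measurable (G k)"
    and f: "f \<in> borel_measurable M"
    and Yf: "\<And>k Z. Z \<in> borel_measurable (G k) \<Longrightarrow>
      (\<integral>\<^sup>+ x. Y k x * Z x \<partial>M) \<le> (\<integral>\<^sup>+ x. f x * Z x \<partial>M)"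
    and w: "integrable M w" "AE x in M. 0 < w x"
    and Q: "\<And>k. AE x in M. nn_cond_exp M (G k) (\<lambda>y. ennreal (w y)) x
        * enn_powr (nn_cond_exp M (G k) (dual_weight p w) x) (p - 1) \<le> Q" "Q < \<top>"
  shows "(\<integral>\<^sup>+ x. enn_powr (SUP k\<in>{..n}. Y k x) p * ennreal (w x) \<partial>M)
    \<le> enn_powr Q (p / (p - 1)) * (ennreal (p powr (p / (p - 1))) * (ennreal ((p / (p - 1)) powr p)
      * (\<integral>\<^sup>+ x. enn_powr (f x) p * ennreal (w x) \<partial>M)))"
    (is "_ \<le> ?C")
proof -
  interpret finite_measure M by (rule fin)
  have sf: "sigma_finite_subalgebra M (G k)" for k
    using fin sub by (intro finite_measure_subalgebra_is_sigma_finite finite_measure_subalgebra.intro)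
      (auto simp: finite_measure_subalgebra_axioms_def)
  define q where "q = p / (p - 1)"
  have q: "1 < q" "q / (q - 1) = p" "(p - 1) * q = p"
    using p by (auto simp: q_def field_simps)
  define u where "u = dual_weight p w"
  define U where "U = (\<lambda>k. nn_cond_exp M (G k) u)"
  define W where "W = (\<lambda>k. nn_cond_exp M (G k) (\<lambda>y. ennreal (w y)))"
  have [measurable]: "w \<in> borel_measurable M" using w(1) by simp
  have u_meas[measurable]: "u \<in> borel_measurable M"
    unfolding u_def dual_weight_def by measurable
  have [measurable]: "U k \<in> borel_measurable M" "W k \<in> borel_measurable M" for k
    by (simp_all add: U_def W_def)
  have [measurable]: "Y k \<in> borel_measurable M" for k
    using measurable_from_subalg[OF sub Y] .
  note [measurable] = f
  have u_pos: "AE x in M. 0 < u x"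
    using w(2) by eventually_elim (simp add: u_def dual_weight_def)
  have u_fin: "AE x in M. u x < \<top>"
    by (simp add: u_def dual_weight_def)
  have U_pos: "AE x in M. 0 < U k x" for k
    unfolding U_def by (rule sigma_finite_subalgebra.nn_cond_exp_pos[OF sf u_meas u_pos])
  have W_pos: "AE x in M. 0 < W k x" for k
    unfolding W_def using w(2) by (intro sigma_finite_subalgebra.nn_cond_exp_pos[OF sf]) auto
  have w_int: "(\<integral>\<^sup>+ x. ennreal (w x) \<partial>M) < \<top>"
  proof -
    have "(\<integral>\<^sup>+ x. ennreal (w x) \<partial>M) \<le> (\<integral>\<^sup>+ x. ennreal (norm (w x)) \<partial>M)"
      by (intro nn_integral_mono ennreal_leI) simp
    also have "\<dots> < \<top>"
      using w(1) by (simp add: integrable_iff_bounded)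
    finally show ?thesis .
  qed
  have W_fin: "AE x in M. W k x < \<top>" for k
  proof -
    have "(\<integral>\<^sup>+ x. 1 * W k x \<partial>M) = (\<integral>\<^sup>+ x. 1 * ennreal (w x) \<partial>M)"
      unfolding W_def by (rule sigma_finite_subalgebra.nn_cond_exp_intg[OF sf]) auto
    then have "(\<integral>\<^sup>+ x. W k x \<partial>M) \<noteq> \<infinity>"
      using w_int by simp
    from nn_integral_PInf_AE[OF _ this] show ?thesis
      by (auto simp: less_top)
  qed
  \<comment> \<open>Here the finiteness of \<open>Q\<close> enters: as \<open>W k\<close> is
    positive, an infinite \<open>U k\<close> would make the product in the characteristic
    infinite.\<close>
  have U_fin: "AE x in M. U k x < \<top>" for k
    using W_pos[of k] Q(1)[of k]
  proof eventually_elim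
    case (elim x)
    show ?case
    proof (rule ccontr)
      assume "\<not> U k x < \<top>"
      then have "W k x * enn_powr (U k x) (p - 1) = \<top>"
        using elim by (simp add: less_top[symmetric] ennreal_mult_top)
      then show False
        using elim Q(2) by (simp add: W_def U_def u_def top_unique)
    qed
  qed
  define S where "S = (\<lambda>x. SUP k\<in>{..n}. Y k x / U k x)"
  have [measurable]: "S \<in> borel_measurable M"
    unfolding S_def by measurable
  \<comment> \<open>restricting to such \<open>A\<close> is needed because \<open>u\<close> itself may fail to be integrable\<close>
  have main: "(\<integral>\<^sup>+ x. indicator A x * (enn_powr (SUP k\<in>{..n}. Y k x) p * ennreal (w x)) \<partial>M) \<le> ?C"
    if A: "A \<in> sets (G 0)" "(\<integral>\<^sup>+ x. indicator A x * u x \<partial>M) < \<top>" for A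
  proof -
    have A_G: "A \<in> sets (G k)" for k
      using A(1) lift_Suc_mono_le[of "\<lambda>k. sets (G k)" 0 k, OF incr] by auto
    have [measurable]: "A \<in> sets M" using A_G[of 0] sub[of 0] by (auto simp: subalgebra_def)
    \<comment> \<open>The indicator confines the right side of the second Doob inequality to
      \<open>A\<close>, where the first one is available.\<close>
    define v where "v = (\<lambda>x. enn_powr (S x) (p - 1) * indicator A x)"
    have v_meas[measurable]: "v \<in> borel_measurable M"
      unfolding v_def by measurable
    define V where "V = (\<lambda>k. nn_cond_exp M (G k) v)"
    have [measurable]: "V k \<in> borel_measurable M" for k
      by (simp add: V_def)
    define R where "R = (\<lambda>x. SUP k\<in>{..n}. V k x / W k x)"
    have [measurable]: "R \<in> borel_measurable M"
      unfolding R_def by measurable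
    have "(\<integral>\<^sup>+ x. indicator A x * (u x * enn_powr (S x) p) \<partial>M)
        \<le> ennreal (q powr p) * (\<integral>\<^sup>+ x. indicator A x * (u x * enn_powr (f x / u x) p) \<partial>M)"
      unfolding S_def U_def q_def
      using U_fin A u_pos u_fin u_meas by (intro doob_density[where G = G and Y = Y, OF p fin sub incr Y f Yf]) (auto simp: U_def)
    also have "(\<integral>\<^sup>+ x. indicator A x * (u x * enn_powr (f x / u x) p) \<partial>M)
        \<le> (\<integral>\<^sup>+ x. enn_powr (f x) p * ennreal (w x) \<partial>M)"
    proof (rule nn_integral_mono_AE)
      show "AE x in M. indicator A x * (u x * enn_powr (f x / u x) p) \<le> enn_powr (f x) p * ennreal (w x)"
        using w(2) by eventually_elim (simp add: u_def dual_weight_mult p indicator_def)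
    qed
    finally have first: "(\<integral>\<^sup>+ x. indicator A x * (u x * enn_powr (S x) p) \<partial>M)
        \<le> ennreal (q powr p) * (\<integral>\<^sup>+ x. enn_powr (f x) p * ennreal (w x) \<partial>M)"
      by (simp add: mult_left_mono)
    have "(\<integral>\<^sup>+ x. indicator (space M) x * (ennreal (w x) * enn_powr (R x) q) \<partial>M)
        \<le> ennreal ((q / (q - 1)) powr q) *
          (\<integral>\<^sup>+ x. indicator (space M) x * (ennreal (w x) * enn_powr (v x / ennreal (w x)) q) \<partial>M)"
      unfolding R_def W_def
    proof (rule doob_density[where G = G and Y = V, OF q(1) fin sub incr])
      show "V k \<in> borel_measurable (G k)" for k by (simp add: V_def)
      show "(\<integral>\<^sup>+ x. V k x * Z x \<partial>M) \<le> (\<integral>\<^sup>+ x. v x * Z x \<partial>M)" if "Z \<in> borel_measurable (G k)" for k Z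
        using sigma_finite_subalgebra.nn_cond_exp_intg[OF sf that v_meas] by (simp add: V_def mult.commute)
      show "AE x in M. nn_cond_exp M (G k) (\<lambda>x. ennreal (w x)) x < \<top>" for k
        using W_fin by (simp add: W_def)
      show "space M \<in> sets (G 0)"
        using sub[of 0] by (metis sets.top subalgebra_def)
      show "(\<integral>\<^sup>+ x. indicator (space M) x * ennreal (w x) \<partial>M) < \<top>"
        using w_int by (simp cong: nn_integral_cong_simp)
    qed (use w(2) in \<open>auto simp: v_def\<close>)
    also have "(\<integral>\<^sup>+ x. indicator (space M) x * (ennreal (w x) * enn_powr (v x / ennreal (w x)) q) \<partial>M)
        = (\<integral>\<^sup>+ x. indicator A x * (u x * enn_powr (S x) p) \<partial>M)"
    proof (rule nn_integral_cong_AE)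
      show "AE x in M. indicator (space M) x * (ennreal (w x) * enn_powr (v x / ennreal (w x)) q)
          = indicator A x * (u x * enn_powr (S x) p)"
        using w(2) AE_space
      proof eventually_elim
        case (elim x)
        then show ?case
          using weight_mult_dual_powr[OF p, of w x "v x"] q(3)
          by (auto simp: q_def[symmetric] u_def[symmetric] v_def indicator_def enn_powr_powr ac_simps)
      qed
    qed
    also have "(\<integral>\<^sup>+ x. indicator (space M) x * (ennreal (w x) * enn_powr (R x) q) \<partial>M)
        = (\<integral>\<^sup>+ x. ennreal (w x) * enn_powr (R x) q \<partial>M)"
      by (intro nn_integral_cong) simp
    finally have second: "(\<integral>\<^sup>+ x. ennreal (w x) * enn_powr (R x) q \<partial>M)
        \<le> ennreal (p powr q) * (\<integral>\<^sup>+ x. indicator A x * (u x * enn_powr (S x) p) \<partial>M)"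
      by (simp add: q(2))
    \<comment> \<open>The quotient \<open>Y k / U k\<close> is \<open>G k\<close>-measurable and one
      of the terms of \<open>S\<close>, so its power is at most \<open>V k\<close> on
      \<open>A\<close>. Multiplying by the power of \<open>U k\<close> and inserting
      \<open>W k / W k\<close> makes the factor bounded by \<open>Q\<close> appear.\<close>
    have "AE x in M. enn_powr (Y k x) (p - 1) * indicator A x \<le> Q * (V k x / W k x)" if "k \<le> n" for k
    proof -
      let ?g = "\<lambda>x. enn_powr (Y k x / U k x) (p - 1) * indicator A x"
      have g: "?g \<in> borel_measurable (G k)"
        unfolding U_def using Y[of k] A_G[of k] by measurable
      have "AE x in M. ?g x = nn_cond_exp M (G k) ?g x"
        by (rule sigma_finite_subalgebra.nn_cond_exp_F_meas[OF sf g])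
      moreover have "AE x in M. nn_cond_exp M (G k) ?g x \<le> V k x"
        unfolding V_def
      proof (rule sigma_finite_subalgebra.nn_cond_exp_mono[OF sf])
        show "AE x in M. ?g x \<le> v x"
          using p that unfolding v_def S_def
          by (intro AE_I2 mult_right_mono enn_powr_mono SUP_upper) auto
      qed auto
      ultimately show ?thesis
        using U_pos[of k] U_fin[of k] W_pos[of k] W_fin[of k] Q(1)[of k]
      proof eventually_elim
        case (elim x)
        show ?case
        proof (cases "x \<in> A")
          case True
          have "Y k x = Y k x / U k x * U k x"
            using elim by (simp add: ennreal_divide_mult_cancel)
          then have "enn_powr (Y k x) (p - 1) = enn_powr (Y k x / U k x) (p - 1) * enn_powr (U k x) (p - 1)"
            by (metis enn_powr_mult)
          also have "\<dots> \<le> V k x * enn_powr (U k x) (p - 1)"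
            using elim True by (intro mult_right_mono) auto
          also have "\<dots> = (V k x / W k x) * (W k x * enn_powr (U k x) (p - 1))"
            using elim by (simp add: ennreal_divide_mult_cancel mult.assoc[symmetric])
          also have "\<dots> \<le> (V k x / W k x) * Q"
            using elim by (intro mult_left_mono) (auto simp: U_def W_def u_def)
          finally show ?thesis using True by (simp add: mult.commute)
        qed simp
      qed
    qed
    then have "AE x in M. \<forall>k\<in>{..n}. enn_powr (Y k x) (p - 1) * indicator A x \<le> Q * (V k x / W k x)"
      by (intro AE_finite_allI) auto
    then have "AE x in M. indicator A x * (enn_powr (SUP k\<in>{..n}. Y k x) p * ennreal (w x))
        \<le> enn_powr Q q * (ennreal (w x) * enn_powr (R x) q)"
    proof eventually_elim
      case (elim x)
      show ?case
      proof (cases "x \<in> A")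
        case True
        have "enn_powr (SUP k\<in>{..n}. Y k x) (p - 1) = (SUP k\<in>{..n}. enn_powr (Y k x) (p - 1))"
          using p by (simp add: enn_powr_SUP)
        also have "\<dots> \<le> Q * R x"
        proof (rule SUP_least)
          fix k assume k: "k \<in> {..n}"
          have "enn_powr (Y k x) (p - 1) \<le> Q * (V k x / W k x)"
            using elim k True by auto
          also have "\<dots> \<le> Q * R x"
            unfolding R_def using k by (intro mult_left_mono SUP_upper) auto
          finally show "enn_powr (Y k x) (p - 1) \<le> Q * R x" .
        qed
        finally have "enn_powr (enn_powr (SUP k\<in>{..n}. Y k x) (p - 1)) q \<le> enn_powr (Q * R x) q"
          using q by (intro enn_powr_mono) auto
        then have "enn_powr (SUP k\<in>{..n}. Y k x) p \<le> enn_powr Q q * enn_powr (R x) q"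
          by (simp add: enn_powr_powr q(3) enn_powr_mult)
        then have "enn_powr (SUP k\<in>{..n}. Y k x) p * ennreal (w x) \<le> enn_powr Q q * enn_powr (R x) q * ennreal (w x)"
          by (rule mult_right_mono) simp
        then show ?thesis using True by (simp add: ac_simps)
      qed simp
    qed
    then have "(\<integral>\<^sup>+ x. indicator A x * (enn_powr (SUP k\<in>{..n}. Y k x) p * ennreal (w x)) \<partial>M)
        \<le> (\<integral>\<^sup>+ x. enn_powr Q q * (ennreal (w x) * enn_powr (R x) q) \<partial>M)"
      by (rule nn_integral_mono_AE)
    also have "\<dots> = enn_powr Q q * (\<integral>\<^sup>+ x. ennreal (w x) * enn_powr (R x) q \<partial>M)"
      by (rule nn_integral_cmult) measurable
    also have "\<dots> \<le> enn_powr Q q * (ennreal (p powr q) *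
        (\<integral>\<^sup>+ x. indicator A x * (u x * enn_powr (S x) p) \<partial>M))"
      by (intro mult_left_mono second) auto
    also have "\<dots> \<le> ?C"
      unfolding q_def[symmetric] by (intro mult_left_mono first) auto
    finally show ?thesis .
  qed
  \<comment> \<open>On \<open>A c\<close> the integral of \<open>u\<close> equals that of
    \<open>U 0\<close>, at most \<open>c\<close> times the total mass. These sets increase and cover
    almost every point because \<open>U 0\<close> is finite almost everywhere.\<close>
  define A where "A = (\<lambda>c::nat. {x \<in> space (G 0). U 0 x \<le> of_nat c})"
  have A_G: "A c \<in> sets (G 0)" for c
    unfolding A_def U_def by measurable
  then have [measurable]: "A c \<in> sets M" for c
    using sub[of 0] by (auto simp: subalgebra_def)
  have A_fin: "(\<integral>\<^sup>+ x. indicator (A c) x * u x \<partial>M) < \<top>" for c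
  proof -
    have "(\<integral>\<^sup>+ x. indicator (A c) x * u x \<partial>M) = (\<integral>\<^sup>+ x. indicator (A c) x * U 0 x \<partial>M)"
      unfolding U_def using A_G[of c]
      by (intro sigma_finite_subalgebra.nn_cond_exp_intg[OF sf, symmetric]) auto
    also have "\<dots> \<le> (\<integral>\<^sup>+ x. of_nat c \<partial>M)"
      by (intro nn_integral_mono) (auto simp: A_def indicator_def)
    also have "\<dots> < \<top>"
      by (simp add: less_top[symmetric] ennreal_mult_eq_top_iff)
    finally show ?thesis .
  qed
  let ?J = "\<lambda>x. enn_powr (SUP k\<in>{..n}. Y k x) p * ennreal (w x)"
  have J[measurable]: "?J \<in> borel_measurable M" by measurable
  have "(\<integral>\<^sup>+ x. ?J x \<partial>M) = (\<integral>\<^sup>+ x. (SUP c. indicator (A c) x * ?J x) \<partial>M)"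
  proof (rule nn_integral_cong_AE)
    show "AE x in M. ?J x = (SUP c. indicator (A c) x * ?J x)"
      using U_fin[of 0] AE_space
    proof eventually_elim
      case (elim x)
      obtain c where c: "U 0 x \<le> of_nat c"
        using elim by (metis ennreal_Ex_less_of_nat infinity_ennreal_def less_imp_le less_top)
      then have "x \<in> A c"
        using elim sub[of 0] by (auto simp: A_def subalgebra_def)
      then have "?J x = indicator (A c) x * ?J x" by simp
      also have "\<dots> \<le> (SUP c. indicator (A c) x * ?J x)"
        by (rule SUP_upper) simp
      finally have "?J x \<le> (SUP c. indicator (A c) x * ?J x)" .
      moreover have "(SUP c. indicator (A c) x * ?J x) \<le> ?J x"
        by (rule SUP_least) (auto simp: indicator_def)
      ultimately show ?case by (rule antisym)
    qed
  qed
  also have "\<dots> = (SUP c. \<integral>\<^sup>+ x. indicator (A c) x * ?J x \<partial>M)"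
  proof (rule nn_integral_monotone_convergence_SUP)
    have "indicator (A i) x \<le> (indicator (A j) x :: ennreal)" if "i \<le> j" for i j x
    proof -
      have "(of_nat i :: ennreal) \<le> of_nat j" using that by simp
      then have "A i \<subseteq> A j" unfolding A_def by (blast intro: order_trans)
      then show ?thesis by (auto simp: indicator_def)
    qed
    then show "incseq (\<lambda>c x. indicator (A c) x * ?J x)"
      by (auto simp: incseq_def le_fun_def intro!: mult_right_mono)
  qed measurable
  also have "\<dots> \<le> ?C"
    by (intro SUP_least main A_G A_fin)
  finally show ?thesis .
qed

section \<open>Convergence and closure of Hilbert space valued martingales\<close>

text \<open>The vector \<open>(1 / \<phi> x) *\<^sub>R x\<close> is the gradient of
  \<open>\<phi>\<close>, so the bracket is a Bregman divergence. Multiplied by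
  \<open>\<phi> x\<close> it becomes \<open>\<phi> x * \<phi> y - (1 + inner x y)\<close>, the
  Cauchy-Schwarz defect of the vectors (1,x) and (1,y). The corresponding difference of squares is
  |y-x|^2 plus the Cauchy-Schwarz defect of x and y, hence at least |y-x|^2.\<close>

lemma bregman_sqrt_lower_bound:
  fixes x y :: "'b::real_inner"
  defines "\<phi> \<equiv> \<lambda>z::'b. sqrt (1 + (norm z)\<^sup>2)"
  assumes K: "norm x \<le> K" "norm y \<le> K"
  shows "(norm (y - x))\<^sup>2 \<le> 2 * (1 + K\<^sup>2)\<^sup>2 * (\<phi> y - \<phi> x - inner ((1 / \<phi> x) *\<^sub>R x) (y - x))"
proof -
  have sq: "(\<phi> z)\<^sup>2 = 1 + (norm z)\<^sup>2" for z
    unfolding \<phi>_def by (rule real_sqrt_pow2) simp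
  have ge1: "1 \<le> \<phi> z" for z unfolding \<phi>_def by simp
  have pos: "0 < \<phi> z" for z using ge1[of z] by linarith
  define c where "c = sqrt (1 + K\<^sup>2)"
  have c: "1 \<le> c" "c\<^sup>2 = 1 + K\<^sup>2"
    unfolding c_def by (simp, rule real_sqrt_pow2) simp
  have le_c: "\<phi> x \<le> c" "\<phi> y \<le> c"
    unfolding \<phi>_def c_def using K by (auto intro!: power_mono)
  define D where "D = \<phi> y - \<phi> x - inner ((1 / \<phi> x) *\<^sub>R x) (y - x)"
  have "\<phi> x * D = \<phi> x * \<phi> y - (\<phi> x)\<^sup>2 - (inner x y - (norm x)\<^sup>2)"
    using pos[of x] by (simp add: D_def algebra_simps power2_eq_square[of "\<phi> x"] inner_diff_right
        power2_norm_eq_inner)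
  then have xD: "\<phi> x * D = \<phi> x * \<phi> y - (1 + inner x y)"
    by (simp add: sq)
  have cs: "(inner x y)\<^sup>2 \<le> (norm x)\<^sup>2 * (norm y)\<^sup>2"
    using Cauchy_Schwarz_ineq[of x y] by (simp add: power2_norm_eq_inner)
  have yx: "(norm (y - x))\<^sup>2 = (norm y)\<^sup>2 - 2 * inner x y + (norm x)\<^sup>2"
    by (simp add: power2_norm_eq_inner inner_diff_left inner_diff_right inner_commute)
  have prod: "(\<phi> x * \<phi> y)\<^sup>2 - (1 + inner x y)\<^sup>2 \<ge> (norm (y - x))\<^sup>2"
  proof -
    have *: "(1 + a) * (1 + b) - (1 + i)\<^sup>2 = (b - 2 * i + a) + (a * b - i\<^sup>2)" for a b i :: real
      by (simp add: algebra_simps power2_eq_square)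
    show ?thesis
      unfolding power_mult_distrib sq yx * using cs by linarith
  qed
  have abs_le: "\<bar>1 + inner x y\<bar> \<le> \<phi> x * \<phi> y"
  proof -
    have "(1 + inner x y)\<^sup>2 \<le> (\<phi> x * \<phi> y)\<^sup>2"
      using prod zero_le_power2[of "norm (y - x)"] by linarith
    then have "\<bar>1 + inner x y\<bar> \<le> \<bar>\<phi> x * \<phi> y\<bar>"
      by (simp only: abs_le_square_iff)
    then show ?thesis using pos[of x] pos[of y] by (simp add: abs_mult)
  qed
  have "(norm (y - x))\<^sup>2 \<le> (\<phi> x * \<phi> y - (1 + inner x y)) * (\<phi> x * \<phi> y + (1 + inner x y))"
    using prod by (simp add: algebra_simps power2_eq_square)
  also have "\<dots> \<le> (\<phi> x * \<phi> y - (1 + inner x y)) * (2 * (\<phi> x * \<phi> y))"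
    using abs_le by (intro mult_left_mono) auto
  also have "\<dots> = D * (2 * (\<phi> x * (\<phi> x * \<phi> y)))"
    unfolding xD[symmetric] by simp
  \<comment> \<open>Three factors would give the cube of \<open>c\<close>; a fourth factor, at least
    1, is added so that the constant contains no square root.\<close>
  also have "\<dots> \<le> D * (2 * (c * (c * (c * c))))"
  proof (intro mult_left_mono mult_mono)
    have "0 \<le> \<phi> x * D" using abs_le xD by linarith
    then show "0 \<le> D" using pos[of x] by (simp add: zero_le_mult_iff)
    show "\<phi> y \<le> c * c" using mult_left_mono[of 1 c c] le_c(2) c(1) by linarith
  qed (use le_c c pos[of x] pos[of y] in auto)
  also have "c * (c * (c * c)) = (1 + K\<^sup>2)\<^sup>2"
    unfolding c(2)[symmetric] by (simp add: power2_eq_square)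
  finally show ?thesis by (simp add: D_def ac_simps)
qed

lemma bregman_sqrt_nonneg:
  fixes x y :: "'b::real_inner"
  defines "\<phi> \<equiv> \<lambda>z::'b. sqrt (1 + (norm z)\<^sup>2)"
  shows "0 \<le> \<phi> y - \<phi> x - inner ((1 / \<phi> x) *\<^sub>R x) (y - x)" (is "0 \<le> ?D")
proof -
  let ?K = "max (norm x) (norm y)"
  have "0 \<le> 2 * (1 + ?K\<^sup>2)\<^sup>2 * ?D"
    unfolding \<phi>_def by (rule order_trans[OF zero_le_power2 bregman_sqrt_lower_bound]) auto
  moreover have "0 < 1 + ?K\<^sup>2"
    by (rule add_pos_nonneg) auto
  ultimately show ?thesis
    by (auto simp: zero_le_mult_iff)
qed

text \<open>On the ball of radius \<open>K\<close> the bound is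
  \<open>a \<le> \<delta> + a\<^sup>2 / \<delta>\<close> combined with the quadratic estimate.
  Outside, the larger of the two norms exceeds \<open>K\<close>, and twice that norm dominates the
  triangle inequality. Every term on the right can be made small in expectation.\<close>

lemma norm_diff_le_bregman:
  fixes x y :: "'b::real_inner"
  defines "\<phi> \<equiv> \<lambda>z::'b. sqrt (1 + (norm z)\<^sup>2)"
  assumes K: "0 \<le> K" and \<delta>: "0 < \<delta>"
  shows "norm (y - x) \<le> \<delta> + 2 * (1 + K\<^sup>2)\<^sup>2 / \<delta> * (\<phi> y - \<phi> x - inner ((1 / \<phi> x) *\<^sub>R x) (y - x))
    + 2 * (indicator {z. K < norm z} x * norm x) + 2 * (indicator {z. K < norm z} y * norm y)"
proof -
  define D where "D = \<phi> y - \<phi> x - inner ((1 / \<phi> x) *\<^sub>R x) (y - x)"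
  have D: "0 \<le> D"
    using bregman_sqrt_nonneg[of y x] by (simp add: D_def \<phi>_def)
  have D': "0 \<le> 2 * (1 + K\<^sup>2)\<^sup>2 / \<delta> * D"
    using D \<delta> by simp
  show ?thesis
  proof (cases "norm x \<le> K \<and> norm y \<le> K")
    case True
    let ?a = "norm (y - x)"
    have "?a \<le> \<delta> + ?a\<^sup>2 / \<delta>"
    proof (cases "?a \<le> \<delta>")
      case False
      then have "?a * \<delta> \<le> ?a\<^sup>2"
        unfolding power2_eq_square by (intro mult_left_mono) auto
      then have "?a \<le> ?a\<^sup>2 / \<delta>"
        using \<delta> by (simp add: le_divide_eq)
      then show ?thesis using \<delta> by linarith
    qed (use \<delta> in \<open>simp add: add_increasing2\<close>)
    also have "?a\<^sup>2 / \<delta> \<le> (2 * (1 + K\<^sup>2)\<^sup>2 * D) / \<delta>"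
      using bregman_sqrt_lower_bound[of x K y] True \<delta> by (intro divide_right_mono) (auto simp: D_def \<phi>_def)
    finally show ?thesis using True by (simp add: D_def)
  next
    case False
    have tri: "norm (y - x) \<le> norm y + norm x" by (rule norm_triangle_ineq4)
    have aux: "b + a \<le> 2 * (of_bool (K < a) * a) + 2 * (of_bool (K < b) * b)"
      if "\<not> (a \<le> K \<and> b \<le> K)" "0 \<le> a" "0 \<le> b" for a b :: real
      using that by (cases "K < a"; cases "K < b") auto
    show ?thesis
      using aux[of "norm x" "norm y"] tri False D' \<delta>
      unfolding D_def[symmetric] indicator_def by simp
  qed
qed

text \<open>A substitute for pulling a measurable factor out of a vector valued conditional
  expectation. For a simple function the integral splits over level sets, each contributing zero.
  The approximating functions are bounded by twice the norm of \<open>Z\<close>, which explains the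
  factor 2 in the dominating function.\<close>

lemma integral_inner_eq_0:
  fixes Y Z :: "'a \<Rightarrow> 'b::{real_inner, banach, second_countable_topology}"
  assumes sub: "subalgebra M G" and Y: "integrable M Y"
    and YA: "\<And>A. A \<in> sets G \<Longrightarrow> (\<integral>x. indicator A x *\<^sub>R Y x \<partial>M) = 0"
    and Z: "Z \<in> borel_measurable G" "\<And>x. norm (Z x) \<le> B"
  shows "(\<integral>x. inner (Z x) (Y x) \<partial>M) = 0"
proof -
  have sp: "space G = space M" using sub by (simp add: subalgebra_def)
  have [measurable]: "Y \<in> borel_measurable M" using Y by simp
  have [measurable]: "Z \<in> borel_measurable M" using measurable_from_subalg[OF sub Z(1)] .
  obtain s where s: "\<And>i. simple_function G (s i)"
    "\<And>x. x \<in> space M \<Longrightarrow> (\<lambda>i. s i x) \<longlonglongrightarrow> Z x"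
    "\<And>i x. x \<in> space M \<Longrightarrow> dist (s i x) 0 \<le> 2 * dist (Z x) 0"
    using borel_measurable_implies_sequence_metric[OF Z(1), of 0] sp by metis
  have s_meas[measurable]: "s i \<in> borel_measurable M" for i
    using measurable_from_subalg[OF sub borel_measurable_simple_function[OF s(1)]] .
  have zero: "(\<integral>x. inner (s i x) (Y x) \<partial>M) = 0" for i
  proof -
    let ?R = "s i ` space M"
    let ?E = "\<lambda>v. s i -` {v} \<inter> space M"
    have fin: "finite ?R" using s(1)[of i] by (simp add: simple_function_def sp)
    have E: "?E v \<in> sets G" if "v \<in> ?R" for v
      using s(1)[of i] that by (auto simp: simple_function_def sp)
    have int: "integrable M (\<lambda>x. indicator (?E v) x *\<^sub>R Y x)" if "v \<in> ?R" for v
      using E[OF that] sub Y by (intro integrable_mult_indicator) (auto simp: subalgebra_def)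
    have "(\<integral>x. inner (s i x) (Y x) \<partial>M) = (\<integral>x. (\<Sum>v\<in>?R. inner v (indicator (?E v) x *\<^sub>R Y x)) \<partial>M)"
    proof (rule Bochner_Integration.integral_cong)
      fix x assume x: "x \<in> space M"
      have "(\<Sum>v\<in>?R. inner v (indicator (?E v) x *\<^sub>R Y x)) = (\<Sum>v\<in>?R. if v = s i x then inner v (Y x) else 0)"
        using x by (intro sum.cong) (auto simp: indicator_def)
      then show "inner (s i x) (Y x) = (\<Sum>v\<in>?R. inner v (indicator (?E v) x *\<^sub>R Y x))"
        using fin x by simp
    qed simp
    also have "\<dots> = (\<Sum>v\<in>?R. \<integral>x. inner v (indicator (?E v) x *\<^sub>R Y x) \<partial>M)"
      using int by (intro Bochner_Integration.integral_sum integrable_inner_right)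
    also have "\<dots> = (\<Sum>v\<in>?R. inner v (\<integral>x. indicator (?E v) x *\<^sub>R Y x \<partial>M))"
      using int by (intro sum.cong integral_inner_right) auto
    also have "\<dots> = 0"
      by (rule sum.neutral) (simp add: YA[OF E])
    finally show ?thesis .
  qed
  have "(\<lambda>i. \<integral>x. inner (s i x) (Y x) \<partial>M) \<longlonglongrightarrow> (\<integral>x. inner (Z x) (Y x) \<partial>M)"
  proof (rule integral_dominated_convergence)
    show "integrable M (\<lambda>x. 2 * B * norm (Y x))"
      using Y by simp
    show "AE x in M. (\<lambda>i. inner (s i x) (Y x)) \<longlonglongrightarrow> inner (Z x) (Y x)"
      using s(2) by (intro AE_I2 tendsto_intros)
    show "AE x in M. norm (inner (s i x) (Y x)) \<le> 2 * B * norm (Y x)" for i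
    proof (rule AE_I2)
      fix x assume "x \<in> space M"
      then have "norm (s i x) \<le> 2 * B"
        using s(3)[of x i] Z(2)[of x] by (simp add: dist_norm)
      then have "norm (s i x) * norm (Y x) \<le> 2 * B * norm (Y x)"
        by (rule mult_right_mono) simp
      then show "norm (inner (s i x) (Y x)) \<le> 2 * B * norm (Y x)"
        using Cauchy_Schwarz_ineq2[of "s i x" "Y x"] by simp
    qed
  qed measurable
  then show ?thesis
    unfolding zero by (metis LIMSEQ_unique tendsto_const)
qed

text \<open>Passes from events to the nonnegative test functions in which domination hypotheses are
  phrased.\<close>

lemma nn_integral_le_of_sets:
  assumes sub: "subalgebra M G"
    and f: "f \<in> borel_measurable M" and g: "g \<in> borel_measurable M"
    and le: "\<And>A. A \<in> sets G \<Longrightarrow> (\<integral>\<^sup>+ x. f x * indicator A x \<partial>M) \<le> (\<integral>\<^sup>+ x. g x * indicator A x \<partial>M)"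
    and Z: "Z \<in> borel_measurable G"
  shows "(\<integral>\<^sup>+ x. f x * Z x \<partial>M) \<le> (\<integral>\<^sup>+ x. g x * Z x \<partial>M)"
  using Z
proof (induction Z rule: borel_measurable_induct)
  case (cong u v)
  have "(\<integral>\<^sup>+ x. k x * v x \<partial>M) = (\<integral>\<^sup>+ x. k x * u x \<partial>M)" for k :: "'a \<Rightarrow> ennreal"
    using cong(3) sub by (intro nn_integral_cong) (simp add: subalgebra_def)
  then show ?case using cong(4) by simp
next
  case (set A)
  then show ?case by (rule le)
next
  case (mult u c)
  note [measurable] = f g measurable_from_subalg[OF sub mult(2)]
  have "(\<integral>\<^sup>+ x. k x * (c * u x) \<partial>M) = c * (\<integral>\<^sup>+ x. k x * u x \<partial>M)" if "k \<in> borel_measurable M" for k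
    using that by (subst nn_integral_cmult[symmetric]) (auto simp: ac_simps)
  then show ?case using mult f g by (simp add: mult_left_mono)
next
  case (add u v)
  note [measurable] = f g measurable_from_subalg[OF sub add(1)] measurable_from_subalg[OF sub add(3)]
  have "(\<integral>\<^sup>+ x. k x * (v x + u x) \<partial>M) = (\<integral>\<^sup>+ x. k x * v x \<partial>M) + (\<integral>\<^sup>+ x. k x * u x \<partial>M)"
    if "k \<in> borel_measurable M" for k
    using that by (subst nn_integral_add[symmetric]) (auto simp: distrib_left)
  then show ?case using add f g by (simp add: add_mono)
next
  case (seq U)
  note [measurable] = f g measurable_from_subalg[OF sub seq(1)]
  have *: "(\<integral>\<^sup>+ x. k x * (SUP i. U i) x \<partial>M) = (SUP i. \<integral>\<^sup>+ x. k x * U i x \<partial>M)"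
    if [measurable]: "k \<in> borel_measurable M" for k
  proof -
    have "(\<integral>\<^sup>+ x. k x * (SUP i. U i) x \<partial>M) = (\<integral>\<^sup>+ x. (SUP i. k x * U i x) \<partial>M)"
      by (intro nn_integral_cong) (simp only: SUP_apply SUP_mult_left_ennreal)
    also have "\<dots> = (SUP i. \<integral>\<^sup>+ x. k x * U i x \<partial>M)"
      using seq(3) by (intro nn_integral_monotone_convergence_SUP)
        (auto simp: incseq_def le_fun_def intro!: mult_left_mono)
    finally show ?thesis .
  qed
  show ?case unfolding *[OF f] *[OF g] by (intro SUP_mono') (rule seq.IH)
qed

section \<open>Norms of martingale increments and the Cauchy property in L^1\<close>

locale filtered_martingale = prob_space M
  for M :: "'a measure" +
  fixes F :: "real \<Rightarrow> 'a measure"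
    and X :: "real \<Rightarrow> 'a \<Rightarrow> 'b::{real_inner, banach, second_countable_topology}"
  assumes filtration: "usual_filtration M F"
    and martingale: "martingale_r M F X"
begin

lemma subalg: "0 \<le> t \<Longrightarrow> subalgebra M (F t)"
  using filtration by (simp add: usual_filtration_def)

lemma sets_F_mono: "0 \<le> s \<Longrightarrow> s \<le> t \<Longrightarrow> sets (F s) \<subseteq> sets (F t)"
  using filtration unfolding usual_filtration_def by blast

lemma subalg_F: "0 \<le> s \<Longrightarrow> s \<le> t \<Longrightarrow> subalgebra (F t) (F s)"
  using subalg[of s] subalg[of t] sets_F_mono[of s t] by (auto simp: subalgebra_def)

lemma adapted: "0 \<le> t \<Longrightarrow> X t \<in> borel_measurable (F t)"
  using martingale by (simp add: martingale_r_def)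

lemma measurable_X: "0 \<le> t \<Longrightarrow> X t \<in> borel_measurable M"
  using measurable_from_subalg[OF subalg adapted] .

lemma integrable_X: "0 \<le> t \<Longrightarrow> integrable M (X t)"
  using martingale by (simp add: martingale_r_def)

lemma in_F_imp_in_M: "0 \<le> t \<Longrightarrow> A \<in> sets (F t) \<Longrightarrow> A \<in> sets M"
  using subalg by (auto simp: subalgebra_def)

lemma integral_indicator_diff:
  assumes "0 \<le> s" "s \<le> t" "A \<in> sets (F s)"
  shows "(\<integral>x. indicator A x *\<^sub>R (X t x - X s x) \<partial>M) = 0"
proof -
  have int: "integrable M (\<lambda>x. indicator A x *\<^sub>R X r x)" if "0 \<le> r" for r
    using in_F_imp_in_M[OF assms(1,3)] integrable_X[OF that] by (intro integrable_mult_indicator)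
  have "(\<integral>x. indicator A x *\<^sub>R X t x \<partial>M) = (\<integral>x. indicator A x *\<^sub>R X s x \<partial>M)"
    using martingale assms unfolding martingale_r_def set_lebesgue_integral_def by blast
  then show ?thesis
    using int[of s] int[of t] assms by (simp add: scaleR_diff_right)
qed

text \<open>The martingale identity is used below only in this scalar form, which avoids vector
  valued conditional expectations.\<close>

lemma integral_inner_diff:
  assumes "0 \<le> s" "s \<le> t" "Z \<in> borel_measurable (F s)" "\<And>x. norm (Z x) \<le> B"
  shows "(\<integral>x. inner (Z x) (X t x - X s x) \<partial>M) = 0"
  using assms integrable_X
  by (intro integral_inner_eq_0[OF subalg[of s]] integral_indicator_diff) auto


text \<open>The norm at time \<open>s\<close> is the inner product with a unit field
  \<open>Z\<close> known at time \<open>s\<close>; replacing \<open>s\<close> by \<open>t\<close>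
  does not change the expectation, and Cauchy-Schwarz bounds the result. The scalar \<open>c\<close>
  covers two uses: \<open>c = 1\<close> for increments from time \<open>m\<close>, and
  \<open>c = 0\<close> for the martingale itself.\<close>

lemma increment_submartingale:
  assumes m: "0 \<le> m" "m \<le> s" "s \<le> t" and A: "A \<in> sets (F s)"
  shows "(\<integral>\<^sup>+ x. ennreal (norm (X s x - c *\<^sub>R X m x)) * indicator A x \<partial>M)
    \<le> (\<integral>\<^sup>+ x. ennreal (norm (X t x - c *\<^sub>R X m x)) * indicator A x \<partial>M)"
proof -
  define Y where "Y = (\<lambda>r x. X r x - c *\<^sub>R X m x)"
  have [measurable]: "X s \<in> borel_measurable (F s)" using m adapted by auto
  have [measurable]: "X m \<in> borel_measurable (F s)"
    using measurable_from_subalg[OF subalg_F adapted] m by blast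
  note [measurable] = A
  have A_M: "A \<in> sets M" using in_F_imp_in_M[OF _ A] m by simp
  \<comment> \<open>Where \<open>Y s\<close> vanishes, \<open>1 / 0 = 0\<close> makes
    \<open>Z\<close> zero, so the bound by 1 holds everywhere.\<close>
  define Z where "Z = (\<lambda>x. indicator A x *\<^sub>R ((1 / norm (Y s x)) *\<^sub>R Y s x))"
  have Z: "Z \<in> borel_measurable (F s)"
    unfolding Z_def Y_def by measurable
  have Z_M[measurable]: "Z \<in> borel_measurable M"
    using measurable_from_subalg[OF subalg[of s] Z] m by simp
  have Z_le: "norm (Z x) \<le> 1" for x
    unfolding Z_def by (auto simp: indicator_def)
  have int: "integrable M (Y r)" if "0 \<le> r" for r
    unfolding Y_def using integrable_X m that by auto
  have intZ: "integrable M (\<lambda>x. inner (Z x) (Y r x))" if "0 \<le> r" for r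
  proof (rule Bochner_Integration.integrable_bound[OF integrable_norm[OF int[OF that]]])
    show "(\<lambda>x. inner (Z x) (Y r x)) \<in> borel_measurable M"
      using int[OF that] by auto
    show "AE x in M. norm (inner (Z x) (Y r x)) \<le> norm (norm (Y r x))"
    proof (rule AE_I2)
      fix x
      have "norm (Z x) * norm (Y r x) \<le> 1 * norm (Y r x)"
        by (rule mult_right_mono[OF Z_le]) simp
      then show "norm (inner (Z x) (Y r x)) \<le> norm (norm (Y r x))"
        using Cauchy_Schwarz_ineq2[of "Z x" "Y r x"] by simp
    qed
  qed
  have intA: "integrable M (\<lambda>x. norm (Y r x) * indicator A x)" if "0 \<le> r" for r
    using integrable_real_mult_indicator[OF A_M integrable_norm[OF int[OF that]]] .
  have nn: "(\<integral>\<^sup>+ x. ennreal (norm (Y r x)) * indicator A x \<partial>M) = ennreal (\<integral>x. norm (Y r x) * indicator A x \<partial>M)"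
    if "0 \<le> r" for r
    using nn_integral_eq_integral[OF intA[OF that]] by (simp add: ennreal_mult'' ennreal_indicator)
  have "inner (Z x) (Y s x) = norm (Y s x) * indicator A x" for x
    by (cases "Y s x = 0") (simp_all add: Z_def power2_norm_eq_inner[symmetric] power2_eq_square)
  then have "(\<integral>x. norm (Y s x) * indicator A x \<partial>M) = (\<integral>x. inner (Z x) (Y s x) \<partial>M)"
    by simp
  also have "\<dots> = (\<integral>x. inner (Z x) (Y t x) \<partial>M)"
  proof -
    have "(\<integral>x. inner (Z x) (Y t x) - inner (Z x) (Y s x) \<partial>M) = (\<integral>x. inner (Z x) (X t x - X s x) \<partial>M)"
      by (simp add: Y_def inner_diff_right[symmetric])
    also have "\<dots> = 0"
      using m by (intro integral_inner_diff[OF _ _ Z Z_le]) auto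
    finally show ?thesis using intZ[of s] intZ[of t] m by simp
  qed
  also have "\<dots> \<le> (\<integral>x. norm (Y t x) * indicator A x \<partial>M)"
  proof (rule integral_mono)
    fix x
    show "inner (Z x) (Y t x) \<le> norm (Y t x) * indicator A x"
    proof (cases "x \<in> A")
      case True
      have "inner (Z x) (Y t x) \<le> norm (Z x) * norm (Y t x)" by (rule norm_cauchy_schwarz)
      also have "\<dots> \<le> 1 * norm (Y t x)" by (rule mult_right_mono[OF Z_le]) simp
      finally show ?thesis using True by simp
    qed (simp add: Z_def)
  qed (use intZ intA m in auto)
  finally have "ennreal (\<integral>x. norm (Y s x) * indicator A x \<partial>M) \<le> ennreal (\<integral>x. norm (Y t x) * indicator A x \<partial>M)"
    by (rule ennreal_leI)
  then have "(\<integral>\<^sup>+ x. ennreal (norm (Y s x)) * indicator A x \<partial>M)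
      \<le> (\<integral>\<^sup>+ x. ennreal (norm (Y t x)) * indicator A x \<partial>M)"
    using nn[of s] nn[of t] m by simp
  then show ?thesis by (simp add: Y_def)
qed

lemma unif_integrable_tail:
  assumes ui: "unif_integrable M X" and "0 < \<eta>"
  obtains K where "0 \<le> K"
    "\<And>t. 0 \<le> t \<Longrightarrow> (\<integral>x. indicator {z. K < norm z} (X t x) * norm (X t x) \<partial>M) \<le> \<eta>"
proof -
  have "eventually (\<lambda>K. (SUP t\<in>{0..}. \<integral>\<^sup>+ x. indicator {y. K < norm (X t y)} x * ennreal (norm (X t x)) \<partial>M) < ennreal \<eta>) at_top"
    using ui \<open>0 < \<eta>\<close> unfolding unif_integrable_def by (intro order_tendstoD) auto
  then have "eventually (\<lambda>K. 0 \<le> K \<and> (SUP t\<in>{0..}. \<integral>\<^sup>+ x. indicator {y. K < norm (X t y)} x * ennreal (norm (X t x)) \<partial>M) < ennreal \<eta>) at_top"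
    by (intro eventually_conj eventually_ge_at_top)
  then obtain K where K: "0 \<le> K"
    "(SUP t\<in>{0..}. \<integral>\<^sup>+ x. indicator {y. K < norm (X t y)} x * ennreal (norm (X t x)) \<partial>M) < ennreal \<eta>"
    by (auto simp: eventually_at_top_linorder)
  show thesis
  proof (rule that[OF K(1)])
    fix t :: real assume t: "0 \<le> t"
    have "ennreal (\<integral>x. indicator {z. K < norm z} (X t x) * norm (X t x) \<partial>M)
        = (\<integral>\<^sup>+ x. ennreal (indicator {z. K < norm z} (X t x) * norm (X t x)) \<partial>M)"
    proof (rule nn_integral_eq_integral[symmetric])
      have [measurable]: "X t \<in> borel_measurable M" using measurable_X[OF t] .
      show "integrable M (\<lambda>x. indicator {z. K < norm z} (X t x) * norm (X t x))"
        by (rule Bochner_Integration.integrable_bound[OF integrable_norm[OF integrable_X[OF t]]])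
          (measurable, auto simp: indicator_def)
    qed auto
    also have "\<dots> = (\<integral>\<^sup>+ x. indicator {y. K < norm (X t y)} x * ennreal (norm (X t x)) \<partial>M)"
      by (intro nn_integral_cong) (auto simp: indicator_def)
    also have "\<dots> \<le> ennreal \<eta>"
      using K(2) t by (meson SUP_upper atLeast_iff le_less_trans less_imp_le)
    finally show "(\<integral>x. indicator {z. K < norm z} (X t x) * norm (X t x) \<partial>M) \<le> \<eta>"
      using \<open>0 < \<eta>\<close> by simp
  qed
qed

text \<open>The lower bound \<open>t0\<close> for \<open>m\<close> is kept because the closure
  argument needs a time \<open>m\<close> beyond a prescribed \<open>t\<close>.\<close>

lemma L1_Cauchy:
  assumes ui: "unif_integrable M X" and "0 < \<epsilon>" "0 \<le> t0"
  obtains m where "t0 \<le> m" "\<And>t. m \<le> t \<Longrightarrow> (\<integral>x. norm (X t x - X m x) \<partial>M) \<le> \<epsilon>"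
proof -
  define \<phi> :: "'b \<Rightarrow> real" where "\<phi> = (\<lambda>z. sqrt (1 + (norm z)\<^sup>2))"
  have \<phi>_pos: "0 < \<phi> z" for z
    unfolding \<phi>_def by (simp add: add_pos_nonneg)
  have \<phi>_le: "\<phi> z \<le> 1 + norm z" for z
    unfolding \<phi>_def by (rule real_le_lsqrt) (auto simp: power2_eq_square algebra_simps)
  have norm_le_\<phi>: "norm z \<le> \<phi> z" for z
    unfolding \<phi>_def by (rule real_le_rsqrt) simp
  have [measurable]: "\<phi> \<in> borel_measurable borel"
    unfolding \<phi>_def by measurable
  have int_\<phi>: "integrable M (\<lambda>x. \<phi> (X t x))" if "0 \<le> t" for t
  proof (rule Bochner_Integration.integrable_bound)
    show "integrable M (\<lambda>x. 1 + norm (X t x))" using integrable_X[OF that] by auto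
    show "(\<lambda>x. \<phi> (X t x)) \<in> borel_measurable M" using measurable_X[OF that] by measurable
    show "AE x in M. norm (\<phi> (X t x)) \<le> norm (1 + norm (X t x))"
      using \<phi>_le \<phi>_pos by (auto simp: less_imp_le)
  qed
  define \<Phi> where "\<Phi> = (\<lambda>t. \<integral>x. \<phi> (X t x) \<partial>M)"
  let ?tail = "\<lambda>K t. \<integral>x. indicator {z. K < norm z} (X t x) * norm (X t x) \<partial>M"
  have int_tail: "integrable M (\<lambda>x. indicator {z. K < norm z} (X t x) * norm (X t x))" if "0 \<le> t" for t K
  proof -
    have [measurable]: "X t \<in> borel_measurable M" using measurable_X[OF that] .
    show ?thesis
      by (rule Bochner_Integration.integrable_bound[OF integrable_norm[OF integrable_X[OF that]]])
        (measurable, auto simp: indicator_def)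
  qed
  define D where "D = (\<lambda>m t x. \<phi> (X t x) - \<phi> (X m x) - inner ((1 / \<phi> (X m x)) *\<^sub>R X m x) (X t x - X m x))"
  have D: "integrable M (D m t)" "(\<integral>x. D m t x \<partial>M) = \<Phi> t - \<Phi> m"
    if m: "0 \<le> m" "m \<le> t" for m t
  proof -
    define Z where "Z = (\<lambda>x. (1 / \<phi> (X m x)) *\<^sub>R X m x)"
    have t: "0 \<le> t" using m by simp
    have Z: "Z \<in> borel_measurable (F m)"
      using adapted[OF m(1)] unfolding Z_def by measurable
    have [measurable]: "Z \<in> borel_measurable M"
      using measurable_from_subalg[OF subalg[OF m(1)] Z] .
    have [measurable]: "X m \<in> borel_measurable M" "X t \<in> borel_measurable M"
      using measurable_X m by auto
    have Z_le: "norm (Z x) \<le> 1" for x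
      using norm_le_\<phi>[of "X m x"] \<phi>_pos[of "X m x"] by (simp add: Z_def)
    have intD: "integrable M (\<lambda>x. X t x - X m x)"
      using integrable_X m t by auto
    have intZ: "integrable M (\<lambda>x. inner (Z x) (X t x - X m x))"
    proof (rule Bochner_Integration.integrable_bound[OF integrable_norm[OF intD]])
      show "AE x in M. norm (inner (Z x) (X t x - X m x)) \<le> norm (norm (X t x - X m x))"
      proof (rule AE_I2)
        fix x
        have "norm (Z x) * norm (X t x - X m x) \<le> 1 * norm (X t x - X m x)"
          by (rule mult_right_mono[OF Z_le]) simp
        then show "norm (inner (Z x) (X t x - X m x)) \<le> norm (norm (X t x - X m x))"
          using Cauchy_Schwarz_ineq2[of "Z x" "X t x - X m x"] by simp
      qed
    qed measurable
    have D_eq: "D m t = (\<lambda>x. \<phi> (X t x) - \<phi> (X m x) - inner (Z x) (X t x - X m x))"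
      by (simp add: D_def Z_def)
    show "integrable M (D m t)"
      unfolding D_eq using int_\<phi>[OF m(1)] int_\<phi>[OF t] intZ by auto
    have "(\<integral>x. D m t x \<partial>M) = \<Phi> t - \<Phi> m - (\<integral>x. inner (Z x) (X t x - X m x) \<partial>M)"
      unfolding D_eq using int_\<phi>[OF m(1)] int_\<phi>[OF t] intZ by (simp add: \<Phi>_def)
    also have "(\<integral>x. inner (Z x) (X t x - X m x) \<partial>M) = 0"
      by (rule integral_inner_diff[OF m Z Z_le])
    finally show "(\<integral>x. D m t x \<partial>M) = \<Phi> t - \<Phi> m" by simp
  qed
  \<comment> \<open>The expected divergence telescopes to \<open>\<Phi> t - \<Phi> m\<close>: its
    linear part pairs the increment with a bounded field known at time \<open>m\<close>.\<close>
  have key: "(\<integral>x. norm (X t x - X m x) \<partial>M)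
      \<le> \<delta> + 2 * (1 + K\<^sup>2)\<^sup>2 / \<delta> * (\<Phi> t - \<Phi> m) + 2 * ?tail K m + 2 * ?tail K t"
    if m: "0 \<le> m" "m \<le> t" and K: "0 \<le> K" and \<delta>: "0 < \<delta>" for m t K \<delta>
  proof -
    have t: "0 \<le> t" using m by simp
    have intD: "integrable M (\<lambda>x. X t x - X m x)"
      using integrable_X m t by auto
    note ints = D(1)[OF m] int_tail[OF m(1), of K] int_tail[OF t, of K]
    have "(\<integral>x. norm (X t x - X m x) \<partial>M) \<le> (\<integral>x. \<delta> + 2 * (1 + K\<^sup>2)\<^sup>2 / \<delta> * D m t x
        + 2 * (indicator {z. K < norm z} (X m x) * norm (X m x))
        + 2 * (indicator {z. K < norm z} (X t x) * norm (X t x)) \<partial>M)"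
    proof (rule integral_mono)
      show "norm (X t x - X m x) \<le> \<delta> + 2 * (1 + K\<^sup>2)\<^sup>2 / \<delta> * D m t x
        + 2 * (indicator {z. K < norm z} (X m x) * norm (X m x))
        + 2 * (indicator {z. K < norm z} (X t x) * norm (X t x))" for x
        unfolding D_def \<phi>_def by (rule norm_diff_le_bregman[OF K \<delta>])
    qed (use ints intD in auto)
    also have "\<dots> = \<delta> + 2 * (1 + K\<^sup>2)\<^sup>2 / \<delta> * (\<integral>x. D m t x \<partial>M) + 2 * ?tail K m + 2 * ?tail K t"
      using ints by (simp add: prob_space)
    finally show ?thesis by (simp add: D(2)[OF m])
  qed
  have \<Phi>_mono: "\<Phi> m \<le> \<Phi> t" if m: "0 \<le> m" "m \<le> t" for m t
  proof -
    have "0 \<le> (\<integral>x. D m t x \<partial>M)"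
      unfolding D_def \<phi>_def by (intro Bochner_Integration.integral_nonneg bregman_sqrt_nonneg)
    then show ?thesis by (simp add: D(2)[OF m])
  qed
  obtain K1 where K1: "0 \<le> K1" "\<And>t. 0 \<le> t \<Longrightarrow> ?tail K1 t \<le> 1"
    using unif_integrable_tail[OF ui zero_less_one] by blast
  have \<Phi>_bdd: "\<Phi> t \<le> K1 + 2" if "0 \<le> t" for t
  proof -
    have "\<phi> (X t x) \<le> 1 + (K1 + indicator {z. K1 < norm z} (X t x) * norm (X t x))" for x
      using \<phi>_le[of "X t x"] K1(1) by (cases "K1 < norm (X t x)") auto
    then have "\<Phi> t \<le> (\<integral>x. 1 + (K1 + indicator {z. K1 < norm z} (X t x) * norm (X t x)) \<partial>M)"
      unfolding \<Phi>_def using int_tail[OF that] int_\<phi>[OF that] by (intro integral_mono) auto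
    also have "\<dots> = 1 + (K1 + ?tail K1 t)"
      using int_tail[OF that, of K1] by (simp add: prob_space)
    finally show ?thesis using K1(2)[OF that] by simp
  qed
  \<comment> \<open>The budget: \<open>\<delta> = \<epsilon> / 4\<close>, the divergence term at
    most \<open>\<epsilon> / 4\<close>, and two tails of at most \<open>\<epsilon> / 8\<close>, each
    counted twice. The radius \<open>K\<close> has to be fixed before \<open>m\<close>, since
    \<open>C\<close> depends on it.\<close>
  obtain K where K: "0 \<le> K" "\<And>t. 0 \<le> t \<Longrightarrow> ?tail K t \<le> \<epsilon> / 8"
    using unif_integrable_tail[OF ui, of "\<epsilon> / 8"] \<open>0 < \<epsilon>\<close> by auto
  define C where "C = 2 * (1 + K\<^sup>2)\<^sup>2 / (\<epsilon> / 4)"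
  have C: "0 < C"
    unfolding C_def using \<open>0 < \<epsilon>\<close> by (intro divide_pos_pos mult_pos_pos zero_less_power add_pos_nonneg) auto
  have bdd: "bdd_above (\<Phi> ` {0..})"
    using \<Phi>_bdd by (auto simp: bdd_above_def)
  have "Sup (\<Phi> ` {0..}) - \<epsilon> / (4 * C) < Sup (\<Phi> ` {0..})"
    using C \<open>0 < \<epsilon>\<close> by simp
  then obtain m0 where m0: "0 \<le> m0" "Sup (\<Phi> ` {0..}) - \<epsilon> / (4 * C) < \<Phi> m0"
    using less_cSup_iff[OF _ bdd] by force
  define m where "m = max m0 t0"
  show thesis
  proof (rule that)
    show "t0 \<le> m" by (simp add: m_def)
    fix t assume t: "m \<le> t"
    have m: "0 \<le> m" using m0 by (simp add: m_def)
    have "\<Phi> t \<le> Sup (\<Phi> ` {0..})"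
      using t m by (intro cSup_upper bdd) auto
    moreover have "\<Phi> m0 \<le> \<Phi> m"
      using m0 by (intro \<Phi>_mono) (auto simp: m_def)
    ultimately have "\<Phi> t - \<Phi> m \<le> \<epsilon> / (4 * C)"
      using m0 by linarith
    then have "C * (\<Phi> t - \<Phi> m) \<le> C * (\<epsilon> / (4 * C))"
      using C by (intro mult_left_mono) auto
    also have "\<dots> = \<epsilon> / 4" using C by simp
    finally have "C * (\<Phi> t - \<Phi> m) \<le> \<epsilon> / 4" .
    moreover have "?tail K m \<le> \<epsilon> / 8" "?tail K t \<le> \<epsilon> / 8"
      using K(2) m t by auto
    moreover have "(\<integral>x. norm (X t x - X m x) \<partial>M)
        \<le> \<epsilon> / 4 + C * (\<Phi> t - \<Phi> m) + 2 * ?tail K m + 2 * ?tail K t"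
      unfolding C_def using \<open>0 < \<epsilon>\<close> by (intro key m t K) auto
    ultimately show "(\<integral>x. norm (X t x - X m x) \<partial>M) \<le> \<epsilon>" by linarith
  qed
qed

end

section \<open>Time grids, maximal bounds and almost sure convergence at infinity\<close>

text \<open>The floor plus one picks the first grid point strictly to the right of \<open>t\<close>,
  as the punctured filter \<open>at_right\<close> demands. With mesh \<open>1 / Suc n\<close>, the
  indices up to \<open>Suc n * Suc n\<close> reach time \<open>Suc n\<close>, hence eventually pass
  any fixed time.\<close>

lemma right_continuous_grid:
  fixes f :: "real \<Rightarrow> 'b::topological_space"
  assumes t: "0 \<le> t" and f: "continuous (at_right t) f"
  obtains k :: "nat \<Rightarrow> nat"
  where "(\<lambda>n. f (real (k n) / real (Suc n))) \<longlonglongrightarrow> f t"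
    "\<forall>\<^sub>F n in sequentially. k n \<le> Suc n * Suc n" "\<And>n. t < real (k n) / real (Suc n)"
proof -
  define k where "k = (\<lambda>n. Suc (nat \<lfloor>t * real (Suc n)\<rfloor>))"
  have k: "real (k n) = real_of_int \<lfloor>t * real (Suc n)\<rfloor> + 1" for n
    using t by (simp add: k_def)
  have lower: "t < real (k n) / real (Suc n)" for n
  proof -
    have "t * real (Suc n) < real (k n)" unfolding k by linarith
    then show ?thesis by (simp add: pos_less_divide_eq)
  qed
  have upper: "real (k n) / real (Suc n) \<le> t + 1 / real (Suc n)" for n
  proof -
    have "real (k n) \<le> t * real (Suc n) + 1" unfolding k by linarith
    then have "real (k n) / real (Suc n) \<le> (t * real (Suc n) + 1) / real (Suc n)"
      by (rule divide_right_mono) simp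
    also have "\<dots> = t + 1 / real (Suc n)" by (simp add: add_divide_distrib)
    finally show ?thesis .
  qed
  have "(\<lambda>n. t + 1 / real (Suc n)) \<longlonglongrightarrow> t + 0"
    by (rule tendsto_add[OF tendsto_const LIMSEQ_Suc[OF lim_1_over_n]])
  then have up: "(\<lambda>n. t + 1 / real (Suc n)) \<longlonglongrightarrow> t" by simp
  have "(\<lambda>n. real (k n) / real (Suc n)) \<longlonglongrightarrow> t"
  proof (rule tendsto_sandwich[OF _ _ tendsto_const up])
    show "\<forall>\<^sub>F n in sequentially. t \<le> real (k n) / real (Suc n)"
      using less_imp_le[OF lower] by (intro always_eventually allI)
    show "\<forall>\<^sub>F n in sequentially. real (k n) / real (Suc n) \<le> t + 1 / real (Suc n)"
      using upper by (intro always_eventually allI)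
  qed
  then have "filterlim (\<lambda>n. real (k n) / real (Suc n)) (at_right t) sequentially"
    using lower by (intro tendsto_imp_filterlim_at_right always_eventually allI)
  from filterlim_compose[OF f[unfolded continuous_within] this]
  have lim: "(\<lambda>n. f (real (k n) / real (Suc n))) \<longlonglongrightarrow> f t" .
  obtain n0 where n0: "t + 1 \<le> real n0" using real_arch_simple by blast
  have ev: "\<forall>\<^sub>F n in sequentially. k n \<le> Suc n * Suc n"
  proof (rule eventually_sequentiallyI)
    fix n assume "n0 \<le> n"
    have "real (k n) / real (Suc n) \<le> t + 1"
      using upper[of n] by (rule order_trans) simp
    also have "\<dots> \<le> real (Suc n)" using n0 \<open>n0 \<le> n\<close> by linarith
    finally have "real (k n) \<le> real (Suc n) * real (Suc n)"
      by (simp add: pos_divide_le_eq)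
    then show "k n \<le> Suc n * Suc n"
      by (simp only: of_nat_mult[symmetric] of_nat_le_iff)
  qed
  show thesis by (rule that[OF lim ev lower])
qed

context filtered_martingale
begin

text \<open>The running maximum estimate with \<open>\<psi>\<close> the indicator of values above
  \<open>\<kappa>\<close> and \<open>\<phi> = \<kappa> * \<psi>\<close>: at the step where the
  maximum first exceeds \<open>\<kappa>\<close>, its new value is greater than
  \<open>\<kappa>\<close>.\<close>

lemma weak_type_finite_grid:
  assumes \<kappa>: "0 < \<kappa>" and m: "0 \<le> m"
    and \<tau>: "\<And>k. m \<le> \<tau> k" "\<And>k. \<tau> k \<le> \<tau> (Suc k)" "\<And>k. \<tau> k \<le> T"
    and \<epsilon>: "0 \<le> \<epsilon>" "(\<integral>x. norm (X T x - X m x) \<partial>M) \<le> \<epsilon>"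
  shows "emeasure M {x \<in> space M. \<kappa> < Max ((\<lambda>k. norm (X (\<tau> k) x - X m x)) ` {..n})} \<le> ennreal (\<epsilon> / \<kappa>)"
proof -
  let ?y = "\<lambda>k x. norm (X (\<tau> k) x - X m x)"
  let ?h = "\<lambda>x. ennreal (norm (X T x - X m x))"
  let ?m = "\<lambda>x. Max ((\<lambda>k. ?y k x) ` {..n})"
  let ?B = "{x \<in> space M. \<kappa> < ?m x}"
  have \<tau>0: "0 \<le> \<tau> k" for k using \<tau>(1)[of k] m by linarith
  have T: "m \<le> T" using \<tau>(1)[of 0] \<tau>(3)[of 0] by linarith
  have [measurable]: "X T \<in> borel_measurable M" "X m \<in> borel_measurable M" "X (\<tau> k) \<in> borel_measurable M" for k
    using measurable_X m T \<tau>0 by auto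
  have [measurable]: "?m \<in> borel_measurable M"
    by (intro borel_measurable_Max) auto
  have "(\<integral>\<^sup>+ x. ennreal (\<kappa> * indicator {\<kappa><..} (?m x)) \<partial>M)
      \<le> (\<integral>\<^sup>+ x. ?h x * ennreal (indicator {\<kappa><..} (?m x)) \<partial>M)"
  proof (rule running_maximum_le[where G = "\<lambda>k. F (\<tau> k)"])
    show "subalgebra M (F (\<tau> k))" for k by (rule subalg[OF \<tau>0])
    show "sets (F (\<tau> k)) \<subseteq> sets (F (\<tau> (Suc k)))" for k by (rule sets_F_mono[OF \<tau>0 \<tau>(2)])
    show "?y k \<in> borel_measurable (F (\<tau> k))" for k
      using adapted[OF \<tau>0, of k] measurable_from_subalg[OF subalg_F[OF m \<tau>(1)] adapted[OF m], of k]
      by measurable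
    show "?h \<in> borel_measurable M" by measurable
    show "(\<integral>\<^sup>+ x. ennreal (?y k x) * Z x \<partial>M) \<le> (\<integral>\<^sup>+ x. ?h x * Z x \<partial>M)"
      if "Z \<in> borel_measurable (F (\<tau> k))" for k Z
    proof (rule nn_integral_le_of_sets[OF subalg[OF \<tau>0] _ _ _ that])
      fix A assume "A \<in> sets (F (\<tau> k))"
      then show "(\<integral>\<^sup>+ x. ennreal (?y k x) * indicator A x \<partial>M) \<le> (\<integral>\<^sup>+ x. ?h x * indicator A x \<partial>M)"
        using increment_submartingale[OF m \<tau>(1) \<tau>(3), of A k 1] by simp
    qed measurable
  qed (use \<kappa> in \<open>auto simp: indicator_def\<close>)
  also have "\<dots> \<le> (\<integral>\<^sup>+ x. ?h x \<partial>M)"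
    by (intro nn_integral_mono) (auto simp: indicator_def)
  also have "\<dots> = ennreal (\<integral>x. norm (X T x - X m x) \<partial>M)"
    using integrable_X m T by (intro nn_integral_eq_integral integrable_norm) auto
  also have "\<dots> \<le> ennreal \<epsilon>" by (rule ennreal_leI[OF \<epsilon>(2)])
  also have "(\<integral>\<^sup>+ x. ennreal (\<kappa> * indicator {\<kappa><..} (?m x)) \<partial>M) = (\<integral>\<^sup>+ x. ennreal \<kappa> * indicator ?B x \<partial>M)"
    using \<kappa> by (intro nn_integral_cong) (auto simp: indicator_def)
  also have "\<dots> = ennreal \<kappa> * emeasure M ?B"
    by (rule nn_integral_cmult_indicator) measurable
  finally have "\<kappa> * measure M ?B \<le> \<epsilon>"
    using \<kappa> \<epsilon> by (simp add: emeasure_eq_measure ennreal_mult[symmetric])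
  then have "measure M ?B \<le> \<epsilon> / \<kappa>"
    using \<kappa> by (simp add: pos_le_divide_eq mult.commute)
  then show ?thesis
    by (simp add: emeasure_eq_measure ennreal_leI)
qed

text \<open>A deviation strictly above \<open>\<kappa>\<close> at some time persists, by right
  continuity, at nearby grid points to the right. The grids are not nested, so the exceptional set
  is the set-theoretic limes inferior of the grid events, whose measure is still bounded by the
  uniform bound on them.\<close>

lemma weak_type_maximal:
  assumes cadlag: "cadlag M X" and \<kappa>: "0 < \<kappa>" and m: "0 \<le> m" and \<epsilon>: "0 \<le> \<epsilon>"
    and le: "\<And>t. m \<le> t \<Longrightarrow> (\<integral>x. norm (X t x - X m x) \<partial>M) \<le> \<epsilon>"
  obtains B where "B \<in> sets M" "emeasure M B \<le> ennreal (\<epsilon> / \<kappa>)"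
    "\<And>x t. x \<in> space M \<Longrightarrow> x \<notin> B \<Longrightarrow> m \<le> t \<Longrightarrow> norm (X t x - X m x) \<le> \<kappa>"
proof -
  \<comment> \<open>The maximum removes times before \<open>m\<close>; the minimum freezes the
    sequence after its last grid point, so that it is monotone and bounded on all indices.\<close>
  define \<tau> where "\<tau> = (\<lambda>n k. max m (real (min k (Suc n * Suc n)) / real (Suc n)))"
  define mx where "mx = (\<lambda>n x. Max ((\<lambda>k. norm (X (\<tau> n k) x - X m x)) ` {..Suc n * Suc n}))"
  define E where "E = (\<lambda>n. {x \<in> space M. \<kappa> < mx n x})"
  have \<tau>0: "0 \<le> \<tau> n k" for n k using m by (simp add: \<tau>_def)
  have [measurable]: "X m \<in> borel_measurable M" "X (\<tau> n k) \<in> borel_measurable M" for n k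
    using measurable_X m \<tau>0 by auto
  have [measurable]: "mx n \<in> borel_measurable M" for n
    unfolding mx_def by (intro borel_measurable_Max) auto
  have E[measurable]: "E n \<in> sets M" for n
    unfolding E_def by measurable
  have E_le: "emeasure M (E n) \<le> ennreal (\<epsilon> / \<kappa>)" for n
    unfolding E_def mx_def
  proof (rule weak_type_finite_grid[OF \<kappa> m])
    show "\<tau> n k \<le> \<tau> n (Suc k)" for k
      unfolding \<tau>_def by (intro max.mono order_refl divide_right_mono of_nat_mono min.mono) auto
    show "\<tau> n k \<le> \<tau> n (Suc n * Suc n)" for k
      unfolding \<tau>_def min.idem by (intro max.mono order_refl divide_right_mono of_nat_mono min.cobounded2) auto
    show "(\<integral>x. norm (X (\<tau> n (Suc n * Suc n)) x - X m x) \<partial>M) \<le> \<epsilon>"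
      by (rule le) (simp add: \<tau>_def)
  qed (use \<epsilon> in \<open>auto simp: \<tau>_def\<close>)
  define I where "I = (\<lambda>N. \<Inter>n\<in>{N..}. E n)"
  have I[measurable]: "I N \<in> sets M" for N
    unfolding I_def by measurable
  show thesis
  proof (rule that)
    show "(\<Union>N. I N) \<in> sets M" by measurable
    have "emeasure M (\<Union>N. I N) = (SUP N. emeasure M (I N))"
      by (rule SUP_emeasure_incseq[symmetric]) (auto simp: I_def incseq_def)
    also have "\<dots> \<le> ennreal (\<epsilon> / \<kappa>)"
    proof (rule SUP_least)
      fix N
      have "emeasure M (I N) \<le> emeasure M (E N)"
        by (intro emeasure_mono E) (auto simp: I_def)
      then show "emeasure M (I N) \<le> ennreal (\<epsilon> / \<kappa>)" using E_le order_trans by blast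
    qed
    finally show "emeasure M (\<Union>N. I N) \<le> ennreal (\<epsilon> / \<kappa>)" .
    fix x t assume x: "x \<in> space M" "x \<notin> (\<Union>N. I N)" and t: "m \<le> t"
    show "norm (X t x - X m x) \<le> \<kappa>"
    proof (rule ccontr)
      assume "\<not> norm (X t x - X m x) \<le> \<kappa>"
      then have gt: "\<kappa> < norm (X t x - X m x)" by simp
      have t0: "0 \<le> t" using m t by simp
      have "continuous (at_right t) (\<lambda>s. X s x)"
        using cadlag x(1) t0 by (simp add: cadlag_def)
      from right_continuous_grid[OF t0 this] obtain k where
        k: "(\<lambda>n. X (real (k n) / real (Suc n)) x) \<longlonglongrightarrow> X t x"
          "\<forall>\<^sub>F n in sequentially. k n \<le> Suc n * Suc n" "\<And>n. t < real (k n) / real (Suc n)"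
        by blast
      have "(\<lambda>n. norm (X (real (k n) / real (Suc n)) x - X m x)) \<longlonglongrightarrow> norm (X t x - X m x)"
        by (intro tendsto_intros k)
      from order_tendstoD(1)[OF this gt] k(2)
      have "\<forall>\<^sub>F n in sequentially. x \<in> E n"
      proof eventually_elim
        case (elim n)
        have "\<tau> n (k n) = real (k n) / real (Suc n)"
          using elim(2) k(3)[of n] t unfolding \<tau>_def by (simp add: min_absorb1 max_absorb2)
        then have "\<kappa> < norm (X (\<tau> n (k n)) x - X m x)" using elim(1) by simp
        also have "\<dots> \<le> mx n x"
          unfolding mx_def using elim(2) by (intro Max_ge) auto
        finally show ?case using x(1) by (simp add: E_def)
      qed
      then show False using x(2) by (auto simp: eventually_sequentially I_def)
    qed
  qed
qed

text \<open>Small L^1 increments after a late time and the weak type bound confine oscillations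
  above a fixed level to events of arbitrarily small measure, whose intersection is null. Over
  countably many levels this gives the Cauchy property along all real times.\<close>

lemma AE_tendsto_mart_limit:
  assumes ui: "unif_integrable M X" and cadlag: "cadlag M X"
  shows "AE x in M. ((\<lambda>t. X t x) \<longlongrightarrow> mart_limit X x) at_top"
proof -
  have osc: "AE x in M. \<exists>m. \<forall>t\<ge>m. norm (X t x - X m x) \<le> \<kappa>" if \<kappa>: "0 < \<kappa>" for \<kappa>
  proof -
    define good where "good = (\<lambda>i B. B \<in> sets M \<and> emeasure M B \<le> ennreal (1 / real (Suc i)) \<and>
        (\<forall>x\<in>space M. x \<notin> B \<longrightarrow> (\<exists>m. \<forall>t\<ge>m. norm (X t x - X m x) \<le> \<kappa>)))"
    have "\<forall>i. \<exists>B. good i B"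
    proof
      fix i
      \<comment> \<open>The weak type bound divides by \<open>\<kappa>\<close>, which leaves
        \<open>1 / real (Suc i)\<close> for the measure of the exceptional set.\<close>
      have pos: "0 < \<kappa> / real (Suc i)" using \<kappa> by simp
      obtain m where m: "0 \<le> m" "\<And>t. m \<le> t \<Longrightarrow> (\<integral>x. norm (X t x - X m x) \<partial>M) \<le> \<kappa> / real (Suc i)"
        using L1_Cauchy[OF ui pos order_refl] by blast
      obtain B where B: "B \<in> sets M" "emeasure M B \<le> ennreal (\<kappa> / real (Suc i) / \<kappa>)"
        "\<And>x t. x \<in> space M \<Longrightarrow> x \<notin> B \<Longrightarrow> m \<le> t \<Longrightarrow> norm (X t x - X m x) \<le> \<kappa>"
        using weak_type_maximal[OF cadlag \<kappa> m(1) less_imp_le[OF pos] m(2)] by blast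
      have "\<kappa> / real (Suc i) / \<kappa> = 1 / real (Suc i)" using \<kappa> by simp
      then have "emeasure M B \<le> ennreal (1 / real (Suc i))" using B(2) by (simp only:)
      then have "good i B" unfolding good_def using B(1,3) by blast
      then show "\<exists>B. good i B" by (rule exI)
    qed
    from choice[OF this] obtain B where good: "\<And>i. good i (B i)" by auto
    have B: "B i \<in> sets M" "emeasure M (B i) \<le> ennreal (1 / real (Suc i))" for i
      using good[of i] by (simp_all add: good_def)
    have "emeasure M (\<Inter>i. B i) \<le> ennreal e" if e: "0 < e" for e
    proof -
      obtain i where i: "1 / real (Suc i) < e" using nat_approx_posE[OF e] by metis
      have "emeasure M (\<Inter>i. B i) \<le> emeasure M (B i)"
        by (intro emeasure_mono B) auto
      also have "\<dots> \<le> ennreal e" by (rule order_trans[OF B(2)[of i] ennreal_leI[OF less_imp_le[OF i]]])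
      finally show ?thesis .
    qed
    then have "emeasure M (\<Inter>i. B i) \<le> 0"
      using ennreal_le_epsilon[of 0 "emeasure M (\<Inter>i. B i)"] by (simp only: add_0)
    then have "(\<Inter>i. B i) \<in> null_sets M"
      using B(1) by (intro null_setsI) auto
    then have "AE x in M. x \<notin> (\<Inter>i. B i)" by (rule AE_not_in)
    then show ?thesis
      using AE_space
    proof eventually_elim
      case (elim x)
      then obtain i where "x \<notin> B i" by blast
      then show ?case using good[of i] elim(2) unfolding good_def by blast
    qed
  qed
  have "AE x in M. \<forall>j::nat. \<exists>m. \<forall>t\<ge>m. norm (X t x - X m x) \<le> 1 / real (Suc j)"
    by (subst AE_all_countable) (auto intro: osc)
  then show ?thesis
  proof eventually_elim
    case (elim x)
    have close: "\<exists>m. \<forall>s\<ge>m. \<forall>t\<ge>m. dist (X s x) (X t x) < e" if e: "0 < e" for e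
    proof -
      have "0 < e / 2" using e by simp
      then obtain j where j: "1 / real (Suc j) < e / 2" using nat_approx_posE by metis
      obtain m where m: "\<And>t. m \<le> t \<Longrightarrow> norm (X t x - X m x) \<le> 1 / real (Suc j)" using elim by blast
      have "dist (X s x) (X t x) < e" if "m \<le> s" "m \<le> t" for s t
        using m[OF that(1)] m[OF that(2)] j dist_triangle2[of "X s x" "X t x" "X m x"]
        unfolding dist_norm by linarith
      then show ?thesis by blast
    qed
    have "Cauchy (\<lambda>n. X (real n) x)"
    proof (rule metric_CauchyI)
      fix e :: real assume "0 < e"
      from close[OF this] obtain m where m: "\<And>s t. m \<le> s \<Longrightarrow> m \<le> t \<Longrightarrow> dist (X s x) (X t x) < e" by blast
      obtain N where "m \<le> real N" using real_arch_simple by blast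
      then have "m \<le> real n" if "N \<le> n" for n
        using that by linarith
      then show "\<exists>N. \<forall>k\<ge>N. \<forall>n\<ge>N. dist (X (real k) x) (X (real n) x) < e"
        using m by blast
    qed
    then obtain l where l: "(\<lambda>n. X (real n) x) \<longlonglongrightarrow> l"
      using Cauchy_convergent convergent_def by blast
    have "((\<lambda>t. X t x) \<longlongrightarrow> l) at_top"
    proof (rule tendstoI)
      fix e :: real assume e: "0 < e"
      from close[of "e / 2"] e obtain m where m: "\<And>s t. m \<le> s \<Longrightarrow> m \<le> t \<Longrightarrow> dist (X s x) (X t x) < e / 2"
        by auto
      have "\<forall>\<^sub>F n in sequentially. dist (X (real n) x) l < e / 2"
        using tendstoD[OF l, of "e / 2"] e by simp
      moreover have "\<forall>\<^sub>F n in sequentially. m \<le> real n"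
        using filterlim_real_sequentially by (simp add: filterlim_at_top)
      ultimately have "\<forall>\<^sub>F n in sequentially. dist (X (real n) x) l < e / 2 \<and> m \<le> real n"
        by (rule eventually_conj)
      from eventually_happens[OF this] obtain n where n: "dist (X (real n) x) l < e / 2" "m \<le> real n"
        by auto
      have "dist (X t x) l < e" if "m \<le> t" for t
        using dist_triangle[of "X t x" l "X (real n) x"] m[OF that n(2)] n(1) by linarith
      then show "\<forall>\<^sub>F t in at_top. dist (X t x) l < e"
        by (auto simp: eventually_at_top_linorder)
    qed
    moreover from this have "mart_limit X x = l"
      unfolding mart_limit_def by (intro tendsto_Lim) auto
    ultimately show ?case by simp
  qed
qed

text \<open>Fatou's lemma along integer times turns the Cauchy estimate into an L^1 bound on
  \<open>g - X m\<close>, and the submartingale property compares \<open>X t\<close> with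
  \<open>X m\<close>. Working with a measurable \<open>g\<close> that is the almost sure limit keeps
  integrals of the terminal value manageable.\<close>

lemma norm_le_closure:
  assumes ui: "unif_integrable M X"
    and lim: "AE x in M. (\<lambda>n. X (real n) x) \<longlonglongrightarrow> g x" and g[measurable]: "g \<in> borel_measurable M"
    and t: "0 \<le> t" and Z: "Z \<in> borel_measurable (F t)"
  shows "(\<integral>\<^sup>+ x. ennreal (norm (X t x)) * Z x \<partial>M) \<le> (\<integral>\<^sup>+ x. ennreal (norm (g x)) * Z x \<partial>M)"
proof (rule nn_integral_le_of_sets[OF subalg[OF t] _ _ _ Z])
  have [measurable]: "X s \<in> borel_measurable M" if "0 \<le> s" for s
    using measurable_X[OF that] .
  show "(\<lambda>x. ennreal (norm (X t x))) \<in> borel_measurable M" "(\<lambda>x. ennreal (norm (g x))) \<in> borel_measurable M"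
    using t by measurable
  fix A assume A: "A \<in> sets (F t)"
  then have [measurable]: "A \<in> sets M" by (rule in_F_imp_in_M[OF t])
  show "(\<integral>\<^sup>+ x. ennreal (norm (X t x)) * indicator A x \<partial>M) \<le> (\<integral>\<^sup>+ x. ennreal (norm (g x)) * indicator A x \<partial>M)"
  proof (rule ennreal_le_epsilon)
    fix e :: real assume e: "0 < e"
    obtain m where m: "t \<le> m" "\<And>s. m \<le> s \<Longrightarrow> (\<integral>x. norm (X s x - X m x) \<partial>M) \<le> e"
      using L1_Cauchy[OF ui e t] by blast
    have m0: "0 \<le> m" using m(1) t by simp
    have [measurable]: "X m \<in> borel_measurable M" by (rule measurable_X[OF m0])
    have "(\<integral>\<^sup>+ x. ennreal (norm (g x - X m x)) \<partial>M)
        \<le> (\<integral>\<^sup>+ x. liminf (\<lambda>n. ennreal (norm (X (real n) x - X m x))) \<partial>M)"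
    proof (rule nn_integral_mono_AE)
      show "AE x in M. ennreal (norm (g x - X m x)) \<le> liminf (\<lambda>n. ennreal (norm (X (real n) x - X m x)))"
        using lim
      proof eventually_elim
        case (elim x)
        have "(\<lambda>n. ennreal (norm (X (real n) x - X m x))) \<longlonglongrightarrow> ennreal (norm (g x - X m x))"
          by (intro tendsto_ennrealI tendsto_intros elim)
        then show ?case by (intro eq_refl lim_imp_Liminf[symmetric]) simp
      qed
    qed
    also have "\<dots> \<le> liminf (\<lambda>n. \<integral>\<^sup>+ x. ennreal (norm (X (real n) x - X m x)) \<partial>M)"
      by (rule nn_integral_liminf) auto
    also have "\<dots> \<le> liminf (\<lambda>n. ennreal e)"
    proof (rule Liminf_mono)
      obtain N where N: "m \<le> real N" using real_arch_simple by blast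
      show "\<forall>\<^sub>F n in sequentially. (\<integral>\<^sup>+ x. ennreal (norm (X (real n) x - X m x)) \<partial>M) \<le> ennreal e"
      proof (rule eventually_sequentiallyI)
        fix n assume "N \<le> n"
        then have n: "m \<le> real n" using N by (meson of_nat_mono order_trans)
        have "(\<integral>\<^sup>+ x. ennreal (norm (X (real n) x - X m x)) \<partial>M) = ennreal (\<integral>x. norm (X (real n) x - X m x) \<partial>M)"
          using integrable_X m0 by (intro nn_integral_eq_integral integrable_norm) auto
        then show "(\<integral>\<^sup>+ x. ennreal (norm (X (real n) x - X m x)) \<partial>M) \<le> ennreal e"
          using m(2)[OF n] by (simp add: ennreal_leI)
      qed
    qed
    also have "\<dots> = ennreal e" by (simp add: Liminf_const)
    finally have gm: "(\<integral>\<^sup>+ x. ennreal (norm (g x - X m x)) \<partial>M) \<le> ennreal e" .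
    have "(\<integral>\<^sup>+ x. ennreal (norm (X t x)) * indicator A x \<partial>M) \<le> (\<integral>\<^sup>+ x. ennreal (norm (X m x)) * indicator A x \<partial>M)"
      using increment_submartingale[OF t order_refl m(1) A, of 0] by simp
    also have "\<dots> \<le> (\<integral>\<^sup>+ x. ennreal (norm (g x)) * indicator A x + ennreal (norm (g x - X m x)) \<partial>M)"
    proof (rule nn_integral_mono)
      fix x
      have "norm (X m x) \<le> norm (g x) + norm (g x - X m x)"
        by (rule norm_triangle_sub[of "X m x" "g x", unfolded norm_minus_commute[of "X m x"]])
      then have "ennreal (norm (X m x)) \<le> ennreal (norm (g x)) + ennreal (norm (g x - X m x))"
        by (simp add: ennreal_plus[symmetric] ennreal_leI del: ennreal_plus)
      then show "ennreal (norm (X m x)) * indicator A x \<le> ennreal (norm (g x)) * indicator A x + ennreal (norm (g x - X m x))"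
        by (auto simp: indicator_def)
    qed
    also have "\<dots> = (\<integral>\<^sup>+ x. ennreal (norm (g x)) * indicator A x \<partial>M) + (\<integral>\<^sup>+ x. ennreal (norm (g x - X m x)) \<partial>M)"
      by (rule nn_integral_add) measurable
    also have "\<dots> \<le> (\<integral>\<^sup>+ x. ennreal (norm (g x)) * indicator A x \<partial>M) + ennreal e"
      by (intro add_left_mono gm)
    finally show "(\<integral>\<^sup>+ x. ennreal (norm (X t x)) * indicator A x \<partial>M)
        \<le> (\<integral>\<^sup>+ x. ennreal (norm (g x)) * indicator A x \<partial>M) + ennreal e" .
  qed
qed

section \<open>Deterministic times in the characteristic and passage to the full maximal
  function\<close>

text \<open>For a constant time the event in the definition is the whole space or empty. The
  instance \<open>s = t\<close> recovers membership in \<open>F t\<close>, and monotonicity of the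
  filtration gives the converse.\<close>

lemma sets_filt_at_const:
  assumes t: "0 \<le> t"
  shows "sets (filt_at M F (\<lambda>_. ennreal t)) = sets (F t)"
proof -
  let ?C = "{A \<in> sets (filt_infty M F). \<forall>s\<ge>0. A \<inter> {x \<in> space M. ennreal t \<le> ennreal s} \<in> sets (F s)}"
  have sp: "space (F s) = space M" if "0 \<le> s" for s
    using subalg[OF that] by (simp add: subalgebra_def)
  have gen: "(\<Union>s\<in>{0..}. sets (F s)) \<subseteq> Pow (space M)"
    using sets.space_closed sp by fastforce
  have sets_inf: "sets (filt_infty M F) = sigma_sets (space M) (\<Union>s\<in>{0..}. sets (F s))"
    unfolding filt_infty_def by (rule sets_measure_of[OF gen])
  have sub_space: "A \<subseteq> space M" if "A \<in> sets (F s)" "0 \<le> s" for A s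
    using sets.sets_into_space[OF that(1)] sp[OF that(2)] by simp
  have "?C = sets (F t)"
  proof (intro set_eqI iffI)
    fix A assume A: "A \<in> ?C"
    then have "A \<subseteq> space M"
      using sets.sets_into_space[of A "filt_infty M F"] by (simp add: filt_infty_def space_measure_of_conv)
    moreover have "A \<inter> {x \<in> space M. ennreal t \<le> ennreal t} \<in> sets (F t)"
      using A t by blast
    ultimately show "A \<in> sets (F t)" by (simp add: Int_absorb2)
  next
    fix A assume A: "A \<in> sets (F t)"
    have "A \<in> sets (filt_infty M F)"
      unfolding sets_inf using A t by (intro sigma_sets.Basic) auto
    moreover have "A \<inter> {x \<in> space M. ennreal t \<le> ennreal s} \<in> sets (F s)" if s: "0 \<le> s" for s
    proof (cases "t \<le> s")
      case True
      then have "A \<inter> {x \<in> space M. ennreal t \<le> ennreal s} = A"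
        using sub_space[OF A t] by (auto simp: ennreal_leI)
      then show ?thesis using A sets_F_mono[OF t True] by auto
    next
      case False
      then show ?thesis using s by (simp add: ennreal_le_iff)
    qed
    ultimately show "A \<in> ?C" by simp
  qed
  then have "sets (filt_at M F (\<lambda>_. ennreal t)) = sigma_sets (space M) (sets (F t))"
    unfolding filt_at_def using sub_space[OF _ t] by (subst sets_measure_of) auto
  also have "\<dots> = sets (F t)"
    using sets.sigma_sets_eq[of "F t"] sp[OF t] by simp
  finally show ?thesis .
qed

text \<open>Constant times are stopping times. The conditional expectations stay relative to
  \<open>filt_at\<close>, the form in which the characteristic is defined, so only the sets of that
  sigma-algebra need to be identified with those of \<open>F t\<close>.\<close>

lemma A_p_at_time:
  assumes t: "0 \<le> t"
  shows "AE x in M. nn_cond_exp M (filt_at M F (\<lambda>_. ennreal t)) (\<lambda>y. ennreal (w y)) x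
    * enn_powr (nn_cond_exp M (filt_at M F (\<lambda>_. ennreal t)) (dual_weight p w) x) (p - 1) \<le> Q_char M F p w"
proof -
  have "stopping_time_r M F (\<lambda>_. ennreal t)"
    unfolding stopping_time_r_def
  proof (intro allI impI)
    fix s :: real assume s: "0 \<le> s"
    have "{x \<in> space M. ennreal t \<le> ennreal s} = (if t \<le> s then space (F s) else {})"
      using s t subalg[OF s] by (auto simp: subalgebra_def ennreal_le_iff)
    then show "{x \<in> space M. ennreal t \<le> ennreal s} \<in> sets (F s)" by simp
  qed
  then have "esssup M (\<lambda>x. nn_cond_exp M (filt_at M F (\<lambda>_. ennreal t)) (\<lambda>y. ennreal (w y)) x
    * enn_powr (nn_cond_exp M (filt_at M F (\<lambda>_. ennreal t)) (dual_weight p w) x) (p - 1)) \<le> Q_char M F p w"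
    unfolding Q_char_def by (intro SUP_upper) simp
  with esssup_AE[of "\<lambda>x. nn_cond_exp M (filt_at M F (\<lambda>_. ennreal t)) (\<lambda>y. ennreal (w y)) x
    * enn_powr (nn_cond_exp M (filt_at M F (\<lambda>_. ennreal t)) (dual_weight p w) x) (p - 1)" M]
  show ?thesis by (auto elim!: eventually_mono intro: order_trans)
qed

text \<open>For each fixed \<open>t\<close>, the grid suprema eventually include times decreasing to
  \<open>t\<close>, so their limes inferior dominates the value at \<open>t\<close> and therefore
  the supremum over \<open>t\<close>. Since grids of different mesh are not nested, Fatou's lemma
  takes the place of monotone convergence.\<close>

lemma weighted_maximal_inequality:
  assumes p: "1 < p" and ui: "unif_integrable M X" and cadlag: "cadlag M X"
    and w: "integrable M w" "AE x in M. 0 < w x" and Q: "Q_char M F p w < \<top>"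
  shows "(\<integral>\<^sup>+ x. enn_powr (maxfun X x) p * ennreal (w x) \<partial>M)
    \<le> enn_powr (Q_char M F p w) (p / (p - 1)) * (ennreal (p powr (p / (p - 1))) * (ennreal ((p / (p - 1)) powr p)
      * (\<integral>\<^sup>+ x. enn_powr (ennreal (norm (mart_limit X x))) p * ennreal (w x) \<partial>M)))"
    (is "_ \<le> ?C")
proof -
  have conv: "AE x in M. (\<lambda>n. X (real n) x) \<longlonglongrightarrow> mart_limit X x"
    using AE_tendsto_mart_limit[OF ui cadlag]
    by eventually_elim (rule filterlim_compose[OF _ filterlim_real_sequentially])
  \<comment> \<open>The limit along integers is measurable as a sequential limit and agrees with
    \<open>mart_limit X\<close> almost everywhere.\<close>
  define g where "g = (\<lambda>x. lim (\<lambda>n. X (real n) x))"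
  have g[measurable]: "g \<in> borel_measurable M"
    unfolding g_def by (intro borel_measurable_lim_metric measurable_X) simp
  have g_eq: "AE x in M. g x = mart_limit X x"
    using conv by eventually_elim (simp add: g_def limI)
  have lim: "AE x in M. (\<lambda>n. X (real n) x) \<longlonglongrightarrow> g x"
    using conv g_eq by eventually_elim simp
  let ?f = "\<lambda>x. ennreal (norm (g x))"
  have C_eq: "?C = enn_powr (Q_char M F p w) (p / (p - 1)) * (ennreal (p powr (p / (p - 1))) * (ennreal ((p / (p - 1)) powr p)
      * (\<integral>\<^sup>+ x. enn_powr (?f x) p * ennreal (w x) \<partial>M)))"
  proof -
    have "(\<integral>\<^sup>+ x. enn_powr (ennreal (norm (mart_limit X x))) p * ennreal (w x) \<partial>M)
        = (\<integral>\<^sup>+ x. enn_powr (?f x) p * ennreal (w x) \<partial>M)"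
      by (rule nn_integral_cong_AE) (use g_eq in \<open>eventually_elim, simp\<close>)
    then show ?thesis by simp
  qed
  let ?t = "\<lambda>n k. real k / real (Suc n)"
  let ?S = "\<lambda>n x. SUP k\<in>{..Suc n * Suc n}. ennreal (norm (X (?t n k) x))"
  have meas[measurable]: "(\<lambda>x. ennreal (norm (X (?t n k) x))) \<in> borel_measurable M" for n k
    using measurable_X[of "?t n k"] by measurable
  have w_meas[measurable]: "w \<in> borel_measurable M" using w(1) by simp
  have grid: "(\<integral>\<^sup>+ x. enn_powr (?S n x) p * ennreal (w x) \<partial>M) \<le> ?C" for n
    unfolding C_eq
  proof (rule weighted_doob_discrete[where G = "\<lambda>k. filt_at M F (\<lambda>_. ennreal (?t n k))", OF p])
    let ?G = "\<lambda>k. filt_at M F (\<lambda>_. ennreal (?t n k))"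
    have sets_G: "sets (?G k) = sets (F (?t n k))" for k
      by (rule sets_filt_at_const) simp
    have sp: "space (?G k) = space M" for k
      by (simp add: filt_at_def space_measure_of_conv)
    show "subalgebra M (?G k)" for k
      using subalg[of "?t n k"] unfolding subalgebra_def sets_G sp by simp
    show "sets (?G k) \<subseteq> sets (?G (Suc k))" for k
      unfolding sets_G by (intro sets_F_mono divide_right_mono) auto
    have bm: "borel_measurable (?G k) = borel_measurable (F (?t n k))" for k
      by (rule measurable_cong_sets[OF sets_G refl])
    show "(\<lambda>x. ennreal (norm (X (?t n k) x))) \<in> borel_measurable (?G k)" for k
      unfolding bm using adapted[of "?t n k"] by measurable
    show "(\<integral>\<^sup>+ x. ennreal (norm (X (?t n k) x)) * Z x \<partial>M) \<le> (\<integral>\<^sup>+ x. ?f x * Z x \<partial>M)"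
      if "Z \<in> borel_measurable (?G k)" for k Z
      using that unfolding bm by (intro norm_le_closure[OF ui lim g]) auto
    show "AE x in M. nn_cond_exp M (?G k) (\<lambda>y. ennreal (w y)) x
      * enn_powr (nn_cond_exp M (?G k) (dual_weight p w) x) (p - 1) \<le> Q_char M F p w" for k
      by (rule A_p_at_time) simp
    show "finite_measure M" by unfold_locales
  qed (use w Q in auto)
  have "(\<integral>\<^sup>+ x. enn_powr (maxfun X x) p * ennreal (w x) \<partial>M)
      \<le> (\<integral>\<^sup>+ x. liminf (\<lambda>n. enn_powr (?S n x) p * ennreal (w x)) \<partial>M)"
  proof (rule nn_integral_mono)
    fix x assume x: "x \<in> space M"
    have le: "ennreal (norm (X t x) powr p * w x) \<le> liminf (\<lambda>n. enn_powr (?S n x) p * ennreal (w x))"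
      if t: "0 \<le> t" for t
    proof -
      have "continuous (at_right t) (\<lambda>s. X s x)"
        using cadlag x t by (simp add: cadlag_def)
      from right_continuous_grid[OF t this] obtain k where
        k: "(\<lambda>n. X (?t n (k n)) x) \<longlonglongrightarrow> X t x" "\<forall>\<^sub>F n in sequentially. k n \<le> Suc n * Suc n"
        by blast
      have "(\<lambda>n. ennreal (norm (X (?t n (k n)) x) powr p * w x)) \<longlonglongrightarrow> ennreal (norm (X t x) powr p * w x)"
        using p by (intro tendsto_ennrealI tendsto_mult tendsto_powr' tendsto_norm k tendsto_const) auto
      then have "ennreal (norm (X t x) powr p * w x) = liminf (\<lambda>n. ennreal (norm (X (?t n (k n)) x) powr p * w x))"
        by (simp add: lim_imp_Liminf)
      also have "\<dots> \<le> liminf (\<lambda>n. enn_powr (?S n x) p * ennreal (w x))"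
      proof (rule Liminf_mono)
        show "\<forall>\<^sub>F n in sequentially. ennreal (norm (X (?t n (k n)) x) powr p * w x) \<le> enn_powr (?S n x) p * ennreal (w x)"
          using k(2)
        proof eventually_elim
          case (elim n)
          have "enn_powr (ennreal (norm (X (?t n (k n)) x))) p \<le> enn_powr (?S n x) p"
            using p elim by (intro enn_powr_mono SUP_upper) auto
          then have "enn_powr (ennreal (norm (X (?t n (k n)) x))) p * ennreal (w x) \<le> enn_powr (?S n x) p * ennreal (w x)"
            by (rule mult_right_mono) simp
          then show ?case by (simp add: ennreal_mult')
        qed
      qed
      finally show ?thesis .
    qed
    have "enn_powr (maxfun X x) p * ennreal (w x) = (SUP t\<in>{0..}. ennreal (norm (X t x) powr p)) * ennreal (w x)"
      using p by (simp add: maxfun_def enn_powr_SUP)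
    also have "\<dots> = (SUP t\<in>{0..}. ennreal (norm (X t x) powr p * w x))"
      by (simp add: SUP_mult_right_ennreal ennreal_mult')
    also have "\<dots> \<le> liminf (\<lambda>n. enn_powr (?S n x) p * ennreal (w x))"
      by (rule SUP_least, rule le) simp
    finally show "enn_powr (maxfun X x) p * ennreal (w x) \<le> liminf (\<lambda>n. enn_powr (?S n x) p * ennreal (w x))" .
  qed
  also have "\<dots> \<le> liminf (\<lambda>n. \<integral>\<^sup>+ x. enn_powr (?S n x) p * ennreal (w x) \<partial>M)"
    by (rule nn_integral_liminf) measurable
  also have "\<dots> \<le> liminf (\<lambda>n. ?C)"
    by (intro Liminf_mono always_eventually allI grid)
  also have "\<dots> = ?C" by (simp add: Liminf_const)
  finally show ?thesis .
qed

end

section \<open>The weighted maximal inequality\<close>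

theorem theorem2:
  fixes M :: "'a measure" and F :: "real \<Rightarrow> 'a measure"
    and X :: "real \<Rightarrow> 'a \<Rightarrow> 'b::{real_inner, banach, second_countable_topology}"
    and w :: "'a \<Rightarrow> real" and p :: real
  assumes "1 < p"
    and "prob_space M" and "complete_measure M"
    and "usual_filtration M F"
    and "martingale_r M F X" and "unif_integrable M X" and "cadlag M X"
    and "weight M F w" and "Q_char M F p w < \<top>"
  shows "wnorm M p w (maxfun X)
         \<le> ennreal (p powr (p / (p - 1)) / (p - 1)) * enn_powr (Q_char M F p w) (1 / (p - 1))
           * wnorm M p w (\<lambda>x. ennreal (norm (mart_limit X x)))"
proof -
  interpret filtered_martingale M F X
    using assms by (simp add: filtered_martingale_def filtered_martingale_axioms_def)
  define q where "q = p / (p - 1)"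
  have p: "1 < p" by fact
  have q: "1 < q" "q * (1 / p) = 1 / (p - 1)"
    using p by (auto simp: q_def field_simps)
  have w: "integrable M w" "AE x in M. 0 < w x"
    using assms by (auto simp: weight_def)
  let ?J = "\<integral>\<^sup>+ x. enn_powr (ennreal (norm (mart_limit X x))) p * ennreal (w x) \<partial>M"
  have "wnorm M p w (maxfun X)
      \<le> enn_powr (enn_powr (Q_char M F p w) q * (ennreal (p powr q) * (ennreal (q powr p) * ?J))) (1 / p)"
    unfolding wnorm_def q_def using p assms w
    by (intro enn_powr_mono weighted_maximal_inequality) auto
  \<comment> \<open>The exponent \<open>q / p\<close> equals \<open>1 / (p - 1)\<close>; it is the
    power of the characteristic and also that of the constant from Doob's inequality in L^q(w). The
    other Doob constant reduces to \<open>q\<close>.\<close>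
  also have "\<dots> = enn_powr (Q_char M F p w) (1 / (p - 1)) *
      (ennreal (p powr (1 / (p - 1))) * (ennreal q * wnorm M p w (\<lambda>x. ennreal (norm (mart_limit X x)))))"
    using p q by (simp add: wnorm_def enn_powr_mult enn_powr_powr powr_powr)
  also have "\<dots> = (ennreal (p powr (1 / (p - 1))) * ennreal q) * enn_powr (Q_char M F p w) (1 / (p - 1))
      * wnorm M p w (\<lambda>x. ennreal (norm (mart_limit X x)))"
    by (simp add: ac_simps)
  also have "ennreal (p powr (1 / (p - 1))) * ennreal q = ennreal (p powr (p / (p - 1)) / (p - 1))"
  proof -
    have "p powr (p / (p - 1)) = p powr (1 + 1 / (p - 1))"
      using p by (intro arg_cong[of _ _ "\<lambda>r. p powr r"]) (simp add: field_simps)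
    also have "\<dots> = p * p powr (1 / (p - 1))"
      using p by (simp add: powr_add)
    finally show ?thesis
      using p q by (simp add: ennreal_mult[symmetric] q_def mult.commute)
  qed
  finally show ?thesis .
qed

end
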